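(* Let $(Z,d,\nu)$ be a complete doubling metric measure space, and let $0<\theta<1$ and $1<p<\infty$. Let $\Omega_0\subset Z$ be a bounded open set satisfying $\overline{\operatorname{codim}}^{\nu}_A(Z\setminus\Omega_0)<\theta p$. If $F\subset\overline{\Omega_0}$ is a closed set satisfying $\underline{\operatorname{codim}}^{\nu}_A(F)>\theta p$, then $\Omega:=\Omega_0\setminus F$ satisfies a $(\theta,p)$-Hardy inequality.
   Context: Write $B(x,r)=\{y\in Z:d(x,y)<r\}$. A Borel measure $\nu$ on $(Z,d)$ is doubling if there is $C_\nu\ge1$ with $0<\nu(B(x,2r))\le C_\nu\nu(B(x,r))<\infty$ for all $x\in Z$, $r>0$. For a set $E\subset Z$ and $r>0$ put $E_r=\{x\in Z:d(x,E)<r\}$. The lower Assouad codimension $\underline{\operatorname{codim}}_A^\nu(E)$ is the supremum of all $t\ge0$ for which there is $C\ge1$ such that $$\frac{\nu(B(x,R)\cap E_r)}{\nu(B(x,R))}\le C\left(\frac rR\right)^t\quad\text{for all }x\in E\text{ and all }0<r\le R<\operatorname{diam}(Z).$$ The upper Assouad codimension $\overline{\operatorname{codim}}_A^\nu(E)$ is the infimum of all $s\ge0$ for which there is $c>0$ such that $$\frac{\nu(B(x,R)\cap E_r)}{\nu(B(x,R))}\ge c\left(\frac rR\right)^s\quad\text{for all }x\in E\text{ and all }0<r\le R<\operatorname{diam}(E);$$ if $\operatorname{diam}(E)=0$, the upper bound on $R$ is omitted in this definition. An open set $\Omega\subset Z$ satisfies a $(\theta,p)$-Hardy inequality if there is $C_{\theta,p}\ge1$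 such that for every $u\in\mathrm{Lip}_c(\Omega)$ (Lipschitz functions with compact support in $\Omega$) $$\int_{\Omega}\frac{|u(x)|^p}{d(x,Z\setminus\Omega)^{\theta p}}\,d\nu(x)\le C_{\theta,p}\int_Z\int_Z\frac{|u(x)-u(y)|^p}{d(x,y)^{\theta p}\,\nu(B(x,d(x,y)))}\,d\nu(y)\,d\nu(x).$$
   Formalization: The complement of Ω₀ is additionally assumed nonempty; for Ω₀ = Z compact the claim fails (e.g. Z a circle, F a point, θp < 1), since the codimension of the empty set is vacuously 0. *)

theory Defs
  imports "HOL-Analysis.Analysis"
begin

definition doubling_measure :: "'a::metric_space measure \<Rightarrow> bool" where
  "doubling_measure \<nu> \<longleftrightarrow> sets \<nu> = sets borel \<and>
     (\<exists>C::real. C \<ge> 1 \<and> (\<forall>x r. r > 0 \<longrightarrow>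
        0 < emeasure \<nu> (ball x (2 * r)) \<and>
        emeasure \<nu> (ball x (2 * r)) \<le> ennreal C * emeasure \<nu> (ball x r) \<and>
        ennreal C * emeasure \<nu> (ball x r) < \<infinity>))"

text \<open>Unlike \<^const>\<open>diameter\<close>, this diameter is infinite on unbounded sets.\<close>

definition ediam :: "'a::metric_space set \<Rightarrow> ennreal" where
  "ediam E = (SUP x\<in>E. SUP y\<in>E. ennreal (dist x y))"

text \<open>
  Since \<^term>\<open>infdist x {} = 0\<close>, the neighbourhood below is only meaningful for nonempty sets.
  It is used only in the codimensions, where a point of the set has already been chosen.
\<close>

definition open_nbhd :: "'a::metric_space set \<Rightarrow> real \<Rightarrow> 'a set" where
  "open_nbhd E r = {x. infdist x E < r}"

definition lower_assouad_codim :: "'a::metric_space measure \<Rightarrow> 'a set \<Rightarrow> ennreal" where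
  "lower_assouad_codim \<nu> E = Sup {ennreal t | t::real. t \<ge> 0 \<and>
     (\<exists>C::real. C \<ge> 1 \<and> (\<forall>x\<in>E. \<forall>r R. 0 < r \<and> r \<le> R \<and> ennreal R < ediam (UNIV :: 'a set) \<longrightarrow>
        measure \<nu> (ball x R \<inter> open_nbhd E r) / measure \<nu> (ball x R) \<le> C * (r / R) powr t))}"

definition upper_assouad_codim :: "'a::metric_space measure \<Rightarrow> 'a set \<Rightarrow> ennreal" where
  "upper_assouad_codim \<nu> E = Inf {ennreal s | s::real. s \<ge> 0 \<and>
     (\<exists>c::real. c > 0 \<and> (\<forall>x\<in>E. \<forall>r R.
        0 < r \<and> r \<le> R \<and> (ediam E = 0 \<or> ennreal R < ediam E) \<longrightarrow>
        measure \<nu> (ball x R \<inter> open_nbhd E r) / measure \<nu> (ball x R) \<ge> c * (r / R) powr s))}"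

definition Lip_c :: "'a::metric_space set \<Rightarrow> ('a \<Rightarrow> real) set" where
  "Lip_c \<Omega> = {u. (\<exists>L. L-lipschitz_on UNIV u) \<and>
                 compact (closure {x. u x \<noteq> 0}) \<and> closure {x. u x \<noteq> 0} \<subseteq> \<Omega>}"

text \<open>
  Division by zero gives zero in HOL. Hence the integrand on the right vanishes on the diagonal,
  and if \<^term>\<open>\<Omega>\<close> is the whole space the integrand on the left vanishes, in agreement with the
  convention that the distance to the empty set is infinite. For all other open sets the
  distance to the complement is positive on \<^term>\<open>\<Omega>\<close>.
\<close>

definition hardy_inequality :: "'a::metric_space measure \<Rightarrow> 'a set \<Rightarrow> real \<Rightarrow> real \<Rightarrow> bool" where
  "hardy_inequality \<nu> \<Omega> \<theta> p \<longleftrightarrow> (\<exists>C::real. C \<ge> 1 \<and> (\<forall>u\<in>Lip_c \<Omega>.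
     (\<integral>\<^sup>+x\<in>\<Omega>. ennreal (\<bar>u x\<bar> powr p / infdist x (- \<Omega>) powr (\<theta> * p)) \<partial>\<nu>)
     \<le> ennreal C * (\<integral>\<^sup>+x. (\<integral>\<^sup>+y. ennreal (\<bar>u x - u y\<bar> powr p /
           (dist x y powr (\<theta> * p) * measure \<nu> (ball x (dist x y)))) \<partial>\<nu>) \<partial>\<nu>)))"

end

theory Submission
  imports Defs
begin

text \<open>
  Write \<open>q = \<theta> * p\<close>, let \<open>S\<^sub>r\<close> be the neighbourhood of radius \<open>r\<close> of a set \<open>S\<close>, and let \<open>V(r)\<close> be
  \<open>r powr -q\<close> times the integral of \<open>\<bar>u\<bar> powr p\<close> over \<open>S\<^sub>r\<close>. Up to constants, the integral of
  \<open>\<bar>u\<bar> powr p / infdist x S powr q\<close> near \<open>S\<close> is the sum of \<open>V(r)\<close> over a geometric sequence of radii.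
  The codimension of \<open>S\<close> decides how \<open>V\<close> behaves under a change of scale.

  The proof rests on one inequality (lemma \<open>averaging\<close>). Comparing \<open>u\<close> at the points of a set \<open>A\<close> with
  its values at the points of a set \<open>B\<close> at distance less than \<open>\<rho>\<close> bounds the integral of
  \<open>\<bar>u\<bar> powr p\<close> over \<open>A\<close> by a multiple of its integral over \<open>B\<close> and the oscillation of \<open>u\<close> at
  scale \<open>\<rho>\<close>. The multiple is small if \<open>A\<close> fills little of each ball of radius \<open>\<rho>\<close>, or moderate if
  \<open>B\<close> fills a known part of it. The oscillations at geometric scales sum to at most the energy
  (lemma \<open>sum_oscillation_le_energy\<close>).

  If \<open>S\<close> is thick, with upper codimension below \<open>q\<close>, then \<open>A = S\<^sub>r\<close> and \<open>B = S\<^sub>l\<^sub>r\<close> with small \<open>l\<close> give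
  \<open>V(r) \<le> V(l r) / 2\<close> plus an oscillation: the loss \<open>l powr -s\<close> from the small size of \<open>B\<close> is outweighed by
  the gain \<open>l powr q\<close> from the change of the weight. For a function that vanishes near \<open>S\<close> this recursion
  stops, and the sum of the \<open>V(r)\<close> is at most a multiple of the energy (lemma \<open>hardy_near_thick_set\<close>).
  If \<open>S\<close> is thin, with lower codimension above \<open>q\<close>, then \<open>A = S\<^sub>l\<^sub>r\<close> and \<open>B = S\<^sub>r\<close> give
  \<open>V(l r) \<le> V(r) / 2\<close> plus an oscillation, and the sum is bounded by the energy and the integral of
  \<open>\<bar>u\<bar> powr p\<close> (lemma \<open>hardy_near_thin_set\<close>).

  The complement of \<open>\<Omega>\<^sub>0\<close> is thick and \<open>F\<close> is thin. The integral of \<open>\<bar>u\<bar> powr p\<close> is bounded by the energy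
  because \<open>\<Omega>\<^sub>0\<close> is bounded and \<open>u\<close> is already controlled on a ball about a point of the complement
  (lemma \<open>poincare_from_ball\<close>). The distance to the complement of \<open>\<Omega>\<^sub>0 - F\<close> is the smaller of the distances
  to the two sets, so the two estimates add up to the theorem.
\<close>

section \<open>Energy, oscillation and doubling measures\<close>

text \<open>
  The right-hand side of the Hardy inequality is this energy with \<open>q = \<theta> * p\<close>. The
  exponent \<open>\<theta>\<close> enters only through this product.
\<close>

definition besov_energy :: "'a::metric_space measure \<Rightarrow> real \<Rightarrow> real \<Rightarrow> ('a \<Rightarrow> real) \<Rightarrow> ennreal" where
  "besov_energy \<nu> q p u =
     (\<integral>\<^sup>+x. (\<integral>\<^sup>+y. ennreal (\<bar>u x - u y\<bar> powr p /
        (dist x y powr q * measure \<nu> (ball x (dist x y)))) \<partial>\<nu>) \<partial>\<nu>)"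

text \<open>
  The contribution of the scale \<open>\<rho>\<close> to the energy, up to the factor \<open>\<rho> powr -q\<close>: pairs of
  points closer than \<open>\<rho>\<close> are counted with the kernel that belongs to distance exactly \<open>\<rho>\<close>.
\<close>

definition oscillation :: "'a::metric_space measure \<Rightarrow> real \<Rightarrow> ('a \<Rightarrow> real) \<Rightarrow> real \<Rightarrow> ennreal" where
  "oscillation \<nu> p u \<rho> =
     (\<integral>\<^sup>+x. (\<integral>\<^sup>+y. (if dist x y < \<rho>
        then ennreal (\<bar>u x - u y\<bar> powr p / measure \<nu> (ball x \<rho>)) else 0) \<partial>\<nu>) \<partial>\<nu>)"

locale doubling_space =
  fixes \<nu> :: "'a::metric_space measure" and D :: real
  assumes sets_borel [measurable_cong]: "sets \<nu> = sets borel"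
    and D_ge_1: "1 \<le> D"
    and emeasure_ball_finite: "emeasure \<nu> (ball x r) < \<infinity>"
    and measure_ball_pos: "0 < r \<Longrightarrow> 0 < measure \<nu> (ball x r)"
    and measure_ball_double: "0 < r \<Longrightarrow> measure \<nu> (ball x (2 * r)) \<le> D * measure \<nu> (ball x r)"
begin

lemma space_UNIV [simp]: "space \<nu> = UNIV"
  using sets_eq_imp_space_eq[OF sets_borel] by simp

lemma open_in_sets [measurable]: "open A \<Longrightarrow> A \<in> sets \<nu>"
  by (simp add: sets_borel)

lemma fmeasurable_inter_ball:
  assumes [measurable]: "A \<in> sets \<nu>"
  shows "A \<inter> ball x r \<in> fmeasurable \<nu>"
proof (rule fmeasurableI)
  have "emeasure \<nu> (A \<inter> ball x r) \<le> emeasure \<nu> (ball x r)"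
    by (intro emeasure_mono) auto
  then show "emeasure \<nu> (A \<inter> ball x r) < \<infinity>"
    using emeasure_ball_finite[of x r] by (simp add: order_le_less_trans)
qed simp

lemma fmeasurable_ball: "ball x r \<in> fmeasurable \<nu>"
  using fmeasurable_inter_ball[of UNIV x r] by (simp add: sets_borel)

text \<open>
  All comparisons of balls below are instances of this form: it allows the centre and the radius
  to change together, and keeps the constant explicit as a power of \<open>D\<close>.
\<close>

lemma measure_ball_doubles:
  assumes "0 < r" "dist x y + s \<le> 2 ^ n * r"
  shows "measure \<nu> (ball y s) \<le> D ^ n * measure \<nu> (ball x r)"
proof -
  have "measure \<nu> (ball x (2 ^ n * r)) \<le> D ^ n * measure \<nu> (ball x r)"
  proof (induction n)
    case (Suc n)
    have "measure \<nu> (ball x (2 ^ Suc n * r)) \<le> D * measure \<nu> (ball x (2 ^ n * r))"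
      using measure_ball_double[of "2 ^ n * r" x] assms(1) by (simp add: mult.assoc)
    also have "\<dots> \<le> D * (D ^ n * measure \<nu> (ball x r))"
      using Suc D_ge_1 by (intro mult_left_mono) auto
    finally show ?case by (simp add: mult.assoc)
  qed simp
  moreover have "measure \<nu> (ball y s) \<le> measure \<nu> (ball x (2 ^ n * r))"
  proof (intro measure_mono_fmeasurable fmeasurable_ball subsetI)
    fix w assume "w \<in> ball y s"
    then show "w \<in> ball x (2 ^ n * r)"
      using dist_triangle[of x w y] assms(2) by simp
  qed (simp add: sets_borel)
  ultimately show ?thesis by linarith
qed

lemma sigma_finite: "sigma_finite_measure \<nu>"
proof
  fix x0 :: 'a
  show "\<exists>A. countable A \<and> A \<subseteq> sets \<nu> \<and> \<Union>A = space \<nu> \<and> (\<forall>a\<in>A. emeasure \<nu> a \<noteq> \<infinity>)"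
  proof (intro exI conjI)
    show "\<Union>(range (\<lambda>n. ball x0 (real n))) = space \<nu>"
      using reals_Archimedean2 by auto
  qed (use emeasure_ball_finite in \<open>auto simp: less_top sets_borel\<close>)
qed

text \<open>
  The balls of radius \<open>\<delta> / 2\<close> about the points of a \<open>\<delta>\<close>-separated set are disjoint, and by
  doubling each one carries a fixed fraction of the measure of a ball that contains them all.
  Hence such sets have bounded cardinality, and one of maximal cardinality is a net.
\<close>

lemma finite_net_ball:
  assumes "0 < \<delta>"
  shows "\<exists>T. finite T \<and> ball (z::'a) R \<subseteq> (\<Union>t\<in>T. ball t \<delta>)"
proof (cases "0 < R")
  case True
  define sep where "sep T \<longleftrightarrow> finite T \<and> T \<subseteq> ball z R \<and> (\<forall>s\<in>T. \<forall>t\<in>T. s \<noteq> t \<longrightarrow> \<delta> \<le> dist s t)" for T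
  obtain n where n: "(2 * R + \<delta>) / (\<delta> / 2) < 2 ^ n"
    using real_arch_pow[of 2 "(2 * R + \<delta>) / (\<delta> / 2)"] by auto
  have card_le: "card T \<le> nat \<lceil>D ^ n\<rceil>" if "sep T" for T
  proof -
    have fin: "finite T" and sub: "T \<subseteq> ball z R" using that by (auto simp: sep_def)
    let ?m = "measure \<nu> (ball z (R + \<delta>))"
    have "real (card T) * ?m = (\<Sum>t\<in>T. ?m)" by simp
    also have "\<dots> \<le> (\<Sum>t\<in>T. D ^ n * measure \<nu> (ball t (\<delta> / 2)))"
    proof (intro sum_mono measure_ball_doubles)
      fix t assume "t \<in> T"
      then have "dist t z < R" using sub by (auto simp: dist_commute)
      then show "dist t z + (R + \<delta>) \<le> 2 ^ n * (\<delta> / 2)"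
        using n assms by (simp add: field_simps)
    qed (use assms in simp)
    also have "\<dots> = D ^ n * (\<Sum>t\<in>T. measure \<nu> (ball t (\<delta> / 2)))"
      by (simp add: sum_distrib_left)
    also have "(\<Sum>t\<in>T. measure \<nu> (ball t (\<delta> / 2))) = measure \<nu> (\<Union>t\<in>T. ball t (\<delta> / 2))"
    proof (rule measure_finite_Union[symmetric])
      show "disjoint_family_on (\<lambda>t. ball t (\<delta> / 2)) T"
        unfolding disjoint_family_on_def
      proof (intro ballI impI)
        fix s t assume "s \<in> T" "t \<in> T" "s \<noteq> t"
        then have "\<delta> \<le> dist s t" using that by (auto simp: sep_def)
        then show "ball s (\<delta> / 2) \<inter> ball t (\<delta> / 2) = {}"
          by (intro disjoint_ballI) simp
      qed
      show "emeasure \<nu> (ball t (\<delta> / 2)) \<noteq> \<infinity>" for t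
        using emeasure_ball_finite[of t "\<delta> / 2"] by auto
    qed (use fin in \<open>auto simp: sets_borel\<close>)
    also have "\<dots> \<le> ?m"
    proof (intro measure_mono_fmeasurable fmeasurable_ball)
      show "(\<Union>t\<in>T. ball t (\<delta> / 2)) \<subseteq> ball z (R + \<delta>)"
      proof
        fix w assume "w \<in> (\<Union>t\<in>T. ball t (\<delta> / 2))"
        then obtain t where "t \<in> T" "dist t w < \<delta> / 2" by auto
        moreover have "dist z t < R" using \<open>t \<in> T\<close> sub by auto
        ultimately show "w \<in> ball z (R + \<delta>)"
          using dist_triangle[of z w t] assms by auto
      qed
    qed (intro open_in_sets open_UN ballI open_ball)
    finally have "real (card T) * ?m \<le> D ^ n * ?m" using D_ge_1 by simp
    moreover have "0 < ?m" using True assms by (intro measure_ball_pos) simp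
    ultimately have "real (card T) \<le> D ^ n" by simp
    then show ?thesis by linarith
  qed
  have "sep {}" by (simp add: sep_def)
  then obtain T where T: "sep T" and max: "\<And>S. sep S \<Longrightarrow> card S \<le> card T"
    using ex_has_greatest_nat[of sep "{}" card "Suc (nat \<lceil>D ^ n\<rceil>)"] card_le
    by (meson le_imp_less_Suc less_imp_le_nat)
  have "ball z R \<subseteq> (\<Union>t\<in>T. ball t \<delta>)"
  proof (rule ccontr)
    assume "\<not> ?thesis"
    then obtain y where y: "y \<in> ball z R" "\<And>t. t \<in> T \<Longrightarrow> \<delta> \<le> dist t y" by force
    have "y \<notin> T" using y(2)[of y] assms by auto
    moreover have "sep (insert y T)"
      using T y by (auto simp: sep_def dist_commute)
    ultimately show False using max[of "insert y T"] T by (simp add: sep_def)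
  qed
  with T show ?thesis by (auto simp: sep_def)
next
  case False
  then show ?thesis by (intro exI[of _ "{}"]) (auto simp: ball_empty)
qed

lemma countable_dense:
  obtains X :: "'a set" where "countable X" "\<And>x \<epsilon>. 0 < \<epsilon> \<Longrightarrow> \<exists>d\<in>X. dist d x < \<epsilon>"
proof -
  fix x0 :: 'a
  have "\<exists>T. finite T \<and> ball x0 (real n) \<subseteq> (\<Union>t\<in>T. ball t (1 / real (Suc k)))" for n k
    by (rule finite_net_ball) simp
  then obtain T where T: "\<And>n k. finite (T n k)"
      "\<And>n k. ball x0 (real n) \<subseteq> (\<Union>t\<in>T n k. ball t (1 / real (Suc k)))"
    by metis
  show thesis
  proof
    show "countable (\<Union>n k. T n k)" by (intro countable_UN countableI_type countable_finite T(1))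
    fix x and \<epsilon> :: real assume "0 < \<epsilon>"
    then obtain k where k: "1 / real (Suc k) < \<epsilon>"
      using nat_approx_posE by blast
    obtain n where "dist x0 x < real n" using reals_Archimedean2 by blast
    then obtain t where "t \<in> T n k" "dist t x < 1 / real (Suc k)"
      using subsetD[OF T(2)[of n k], of x] by auto
    then show "\<exists>d\<in>(\<Union>n k. T n k). dist d x < \<epsilon>"
      using k by (intro bexI[of _ t]) auto
  qed
qed

text \<open>
  Tonelli's theorem is applied to functions of \<open>dist x y\<close>. For a general metric space these
  need not be measurable for the product of the Borel algebras; here separability, which follows
  from doubling, writes the strict sublevel sets as countable unions of rectangles.
\<close>

lemma measurable_dist_pair: "(\<lambda>z. dist (fst z) (snd z)) \<in> borel_measurable (\<nu> \<Otimes>\<^sub>M \<nu>)"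
proof (rule borel_measurableI_less)
  fix a :: real
  obtain X :: "'a set" where X: "countable X" "\<And>x \<epsilon>. 0 < \<epsilon> \<Longrightarrow> \<exists>d\<in>X. dist d x < \<epsilon>"
    using countable_dense by blast
  have "{z \<in> space (\<nu> \<Otimes>\<^sub>M \<nu>). dist (fst z) (snd z) < a}
      = (\<Union>d\<in>X. \<Union>s\<in>\<rat>. ball d s \<times> ball d (a - s))" (is "?L = ?R")
  proof (intro set_eqI iffI)
    fix z assume "z \<in> ?L"
    then have a: "dist (fst z) (snd z) < a" by simp
    then obtain d where d: "d \<in> X" "dist d (fst z) < (a - dist (fst z) (snd z)) / 2"
      using X(2)[of "(a - dist (fst z) (snd z)) / 2" "fst z"] by auto
    have "dist d (fst z) < a - dist d (snd z)"
      using d(2) dist_triangle[of d "snd z" "fst z"] by (simp add: field_simps)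
    then obtain s where "s \<in> \<rat>" "dist d (fst z) < s" "s < a - dist d (snd z)"
      using Rats_dense_in_real by blast
    then show "z \<in> ?R" using d(1) by (cases z) force
  next
    fix z assume "z \<in> ?R"
    then obtain d s where "dist d (fst z) < s" "dist d (snd z) < a - s" by auto
    then show "z \<in> ?L" using dist_triangle3[of "fst z" "snd z" d] by (simp add: space_pair_measure)
  qed
  also have "\<dots> \<in> sets (\<nu> \<Otimes>\<^sub>M \<nu>)"
    by (intro sets.countable_UN'' X(1) countable_rat pair_measureI) (auto simp: sets_borel)
  finally show "{z \<in> space (\<nu> \<Otimes>\<^sub>M \<nu>). dist (fst z) (snd z) < a} \<in> sets (\<nu> \<Otimes>\<^sub>M \<nu>)" .
qed

lemma measurable_dist [measurable]:
  assumes "f \<in> measurable N \<nu>" "g \<in> measurable N \<nu>"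
  shows "(\<lambda>z. dist (f z) (g z)) \<in> borel_measurable N"
  using measurable_compose[OF measurable_Pair[OF assms] measurable_dist_pair] by simp

lemma measurable_measure_ball [measurable]: "(\<lambda>x. measure \<nu> (ball x r)) \<in> borel_measurable \<nu>"
proof -
  interpret sigma_finite_measure \<nu> by (rule sigma_finite)
  have "measure \<nu> (ball x r) = enn2real (\<integral>\<^sup>+y. (if dist x y < r then 1 else 0) \<partial>\<nu>)" for x
  proof -
    have "(\<integral>\<^sup>+y. (if dist x y < r then 1 else 0) \<partial>\<nu>) = (\<integral>\<^sup>+y. indicator (ball x r) y \<partial>\<nu>)"
      by (intro nn_integral_cong) (auto simp: indicator_def)
    then show ?thesis by (simp add: measure_def sets_borel)
  qed
  then show ?thesis by simp
qed

end

section \<open>The averaging inequality\<close>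

lemma powr_triangle:
  fixes a b p :: real
  assumes "0 < p"
  shows "\<bar>a\<bar> powr p \<le> 2 powr p * (\<bar>a - b\<bar> powr p + \<bar>b\<bar> powr p)"
proof -
  define m where "m = max \<bar>a - b\<bar> \<bar>b\<bar>"
  have "\<bar>a - b\<bar> \<le> m" "\<bar>b\<bar> \<le> m" by (simp_all add: m_def)
  then have "\<bar>a\<bar> \<le> 2 * m" by linarith
  then have "\<bar>a\<bar> powr p \<le> (2 * m) powr p" using assms by (intro powr_mono2) auto
  also have "\<dots> = 2 powr p * m powr p" by (simp add: powr_mult m_def)
  also have "m powr p \<le> \<bar>a - b\<bar> powr p + \<bar>b\<bar> powr p" by (simp add: m_def max_def)
  finally show ?thesis by simp
qed

context doubling_space
begin

text \<open>
  For \<open>x \<in> A\<close> the value \<open>u x\<close> is compared with \<open>u y\<close> for all \<open>y \<in> B\<close> in the ball of radius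
  \<open>\<rho>\<close> about \<open>x\<close>, and the comparison is averaged over these \<open>y\<close>. The differences give the
  oscillation. In the remaining term Tonelli's theorem lets each \<open>y \<in> B\<close> collect the points
  \<open>x \<in> A\<close> near it, of which there is only a fraction \<open>\<beta>\<close>. The factor \<open>\<beta> / \<alpha>\<close> in front of the
  integral over \<open>B\<close> is what the codimension hypotheses control.
\<close>

lemma averaging:
  assumes [measurable]: "A \<in> sets \<nu>" "B \<in> sets \<nu>" "u \<in> borel_measurable \<nu>"
    and p: "0 < p" and \<rho>: "0 < \<rho>" and \<alpha>: "0 < \<alpha>" and \<beta>: "0 \<le> \<beta>"
    and A: "\<And>x. x \<in> A \<Longrightarrow> \<alpha> * measure \<nu> (ball x \<rho>) \<le> measure \<nu> (B \<inter> ball x \<rho>)"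
    and B: "\<And>y. y \<in> B \<Longrightarrow> measure \<nu> (A \<inter> ball y \<rho>) \<le> \<beta> * measure \<nu> (ball y \<rho>)"
  shows "(\<integral>\<^sup>+x\<in>A. ennreal (\<bar>u x\<bar> powr p) \<partial>\<nu>)
    \<le> ennreal (2 powr p / \<alpha>) *
        (ennreal (D * \<beta>) * (\<integral>\<^sup>+y\<in>B. ennreal (\<bar>u y\<bar> powr p) \<partial>\<nu>) + oscillation \<nu> p u \<rho>)"
proof -
  interpret sigma_finite_measure \<nu> by (rule sigma_finite)
  interpret pair_sigma_finite \<nu> \<nu> ..
  define c where "c = 2 powr p / \<alpha>"
  have c: "0 \<le> c" using \<alpha> by (simp add: c_def)
  have mpos: "0 < measure \<nu> (ball x \<rho>)" for x using \<rho> by (rule measure_ball_pos)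
  define P where "P x y = (if dist x y < \<rho> then ennreal (\<bar>u x - u y\<bar> powr p / measure \<nu> (ball x \<rho>)) else 0)" for x y
  define Q where "Q x y = indicator A x * indicator B y * (if dist x y < \<rho> then ennreal (\<bar>u y\<bar> powr p / measure \<nu> (ball x \<rho>)) else 0)" for x y
  have [measurable]: "(\<lambda>z. P (fst z) (snd z)) \<in> borel_measurable (\<nu> \<Otimes>\<^sub>M \<nu>)"
    unfolding P_def by measurable
  have [measurable]: "(\<lambda>z. Q (fst z) (snd z)) \<in> borel_measurable (\<nu> \<Otimes>\<^sub>M \<nu>)"
    unfolding Q_def by measurable
  have [measurable]: "P x \<in> borel_measurable \<nu>" "Q x \<in> borel_measurable \<nu>" for x
    unfolding P_def Q_def by measurable
  have "ennreal (\<bar>u x\<bar> powr p) * indicator A x \<le> (\<integral>\<^sup>+y. ennreal c * (P x y + Q x y) \<partial>\<nu>)" for x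
  proof (cases "x \<in> A")
    case True
    \<comment> \<open>Spread the value at \<open>x\<close> over \<open>B \<inter> ball x \<rho>\<close>, whose measure is at least \<open>\<alpha> * measure \<nu> (ball x \<rho>)\<close>.\<close>
    let ?k = "\<bar>u x\<bar> powr p / (\<alpha> * measure \<nu> (ball x \<rho>))"
    have "\<bar>u x\<bar> powr p = ?k * (\<alpha> * measure \<nu> (ball x \<rho>))"
      using mpos[of x] \<alpha> by simp
    also have "ennreal \<dots> \<le> ennreal (?k * measure \<nu> (B \<inter> ball x \<rho>))"
      using A[OF True] mpos[of x] \<alpha> by (intro ennreal_leI mult_left_mono) auto
    also have "\<dots> = ennreal ?k * emeasure \<nu> (B \<inter> ball x \<rho>)"
      using fmeasurable_inter_ball[of B x \<rho>] mpos[of x] \<alpha>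
      by (subst ennreal_mult) (auto simp: emeasure_eq_measure2)
    also have "\<dots> = (\<integral>\<^sup>+y. ennreal ?k * indicator (B \<inter> ball x \<rho>) y \<partial>\<nu>)"
      by (subst nn_integral_cmult_indicator) (auto simp: sets_borel)
    also have "\<dots> \<le> (\<integral>\<^sup>+y. ennreal c * (P x y + Q x y) \<partial>\<nu>)"
    proof (rule nn_integral_mono)
      fix y
      show "ennreal ?k * indicator (B \<inter> ball x \<rho>) y \<le> ennreal c * (P x y + Q x y)"
      proof (cases "y \<in> B \<inter> ball x \<rho>")
        case in_ball: True
        have "?k \<le> 2 powr p * (\<bar>u x - u y\<bar> powr p + \<bar>u y\<bar> powr p) / (\<alpha> * measure \<nu> (ball x \<rho>))"
          using powr_triangle[OF p, of "u x" "u y"] mpos[of x] \<alpha> by (intro divide_right_mono) auto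
        also have "\<dots> = c * (\<bar>u x - u y\<bar> powr p / measure \<nu> (ball x \<rho>) + \<bar>u y\<bar> powr p / measure \<nu> (ball x \<rho>))"
          by (simp add: c_def field_simps add_divide_distrib)
        finally have "ennreal ?k \<le> ennreal \<dots>" by (rule ennreal_leI)
        then show ?thesis
          using in_ball True c mpos[of x] by (simp add: P_def Q_def ennreal_mult ennreal_plus)
      qed simp
    qed
    finally show ?thesis using True by simp
  qed simp
  then have "(\<integral>\<^sup>+x\<in>A. ennreal (\<bar>u x\<bar> powr p) \<partial>\<nu>) \<le> (\<integral>\<^sup>+x. (\<integral>\<^sup>+y. ennreal c * (P x y + Q x y) \<partial>\<nu>) \<partial>\<nu>)"
    by (intro nn_integral_mono)
  also have "\<dots> = ennreal c * ((\<integral>\<^sup>+x. (\<integral>\<^sup>+y. Q x y \<partial>\<nu>) \<partial>\<nu>) + (\<integral>\<^sup>+x. (\<integral>\<^sup>+y. P x y \<partial>\<nu>) \<partial>\<nu>))"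
    by (simp add: nn_integral_cmult nn_integral_add add.commute)
  also have "(\<integral>\<^sup>+x. (\<integral>\<^sup>+y. Q x y \<partial>\<nu>) \<partial>\<nu>) = (\<integral>\<^sup>+y. (\<integral>\<^sup>+x. Q x y \<partial>\<nu>) \<partial>\<nu>)"
    by (rule Fubini'[symmetric]) (simp add: case_prod_beta)
  also have "\<dots> \<le> (\<integral>\<^sup>+y. ennreal (D * \<beta>) * (ennreal (\<bar>u y\<bar> powr p) * indicator B y) \<partial>\<nu>)"
  proof (rule nn_integral_mono)
    fix y
    show "(\<integral>\<^sup>+x. Q x y \<partial>\<nu>) \<le> ennreal (D * \<beta>) * (ennreal (\<bar>u y\<bar> powr p) * indicator B y)"
    proof (cases "y \<in> B")
      case True
      let ?k = "\<bar>u y\<bar> powr p * (D / measure \<nu> (ball y \<rho>))"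
      have "(\<integral>\<^sup>+x. Q x y \<partial>\<nu>) \<le> (\<integral>\<^sup>+x. ennreal ?k * indicator (A \<inter> ball y \<rho>) x \<partial>\<nu>)"
      proof (rule nn_integral_mono)
        fix x
        show "Q x y \<le> ennreal ?k * indicator (A \<inter> ball y \<rho>) x"
        proof (cases "x \<in> A \<and> dist x y < \<rho>")
          case near: True
          have "measure \<nu> (ball y \<rho>) \<le> D ^ 1 * measure \<nu> (ball x \<rho>)"
            using near \<rho> by (intro measure_ball_doubles) auto
          then have "1 / measure \<nu> (ball x \<rho>) \<le> D / measure \<nu> (ball y \<rho>)"
            using mpos[of x] mpos[of y] by (simp add: field_simps)
          then have "\<bar>u y\<bar> powr p / measure \<nu> (ball x \<rho>) \<le> ?k"
            using mult_left_mono[of "1 / measure \<nu> (ball x \<rho>)" "D / measure \<nu> (ball y \<rho>)" "\<bar>u y\<bar> powr p"] by simp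
          then show ?thesis using near True by (simp add: Q_def dist_commute ennreal_leI)
        qed (auto simp: Q_def)
      qed
      also have "\<dots> = ennreal ?k * emeasure \<nu> (A \<inter> ball y \<rho>)"
        by (subst nn_integral_cmult_indicator) (auto simp: sets_borel)
      also have "\<dots> = ennreal (?k * measure \<nu> (A \<inter> ball y \<rho>))"
        using fmeasurable_inter_ball[of A y \<rho>] D_ge_1
        by (subst ennreal_mult) (auto simp: emeasure_eq_measure2)
      also have "\<dots> \<le> ennreal (?k * (\<beta> * measure \<nu> (ball y \<rho>)))"
        using B[OF True] D_ge_1 by (intro ennreal_leI mult_left_mono) auto
      also have "?k * (\<beta> * measure \<nu> (ball y \<rho>)) = D * \<beta> * \<bar>u y\<bar> powr p"
        using mpos[of y] by simp
      finally show ?thesis using True D_ge_1 \<beta> by (simp add: ennreal_mult)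
    qed (simp add: Q_def)
  qed
  also have "\<dots> = ennreal (D * \<beta>) * (\<integral>\<^sup>+y\<in>B. ennreal (\<bar>u y\<bar> powr p) \<partial>\<nu>)"
    by (simp add: nn_integral_cmult)
  also have "(\<integral>\<^sup>+x. (\<integral>\<^sup>+y. P x y \<partial>\<nu>) \<partial>\<nu>) = oscillation \<nu> p u \<rho>"
    by (simp add: oscillation_def P_def)
  finally show ?thesis
    by (simp add: c_def add_right_mono mult_left_mono)
qed

end

section \<open>Summation over geometric scales\<close>

text \<open>
  Only the scales larger than \<open>d\<close> contribute, and the sum is a geometric series dominated by the
  smallest of them.
\<close>

lemma sum_scales_le:
  fixes a d l q :: real
  assumes "0 < l" "l < 1" "0 < q" "0 < a" "0 < d"
  shows "(\<Sum>m<N. if d < a * l ^ m then 1 / (a * l ^ m) powr q else 0) \<le> 1 / (1 - l powr q) / d powr q"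
proof -
  define k where "k = l powr q"
  have k: "0 < k" "k < 1" using assms powr_less_mono2[of q l 1] by (auto simp: k_def)
  have full: "(\<Sum>m<Suc N. 1 / (a * l ^ m) powr q) \<le> 1 / (1 - k) / (a * l ^ N) powr q" for N
  proof (induction N)
    case 0
    have "1 \<le> 1 / (1 - k)" using k by simp
    then show ?case using divide_right_mono[of 1 "1 / (1 - k)" "a powr q"] by simp
  next
    case (Suc N)
    define X where "X = 1 / (a * l ^ N) powr q"
    have X: "1 / (a * l ^ Suc N) powr q = X / k"
      using assms by (simp add: X_def k_def powr_mult)
    have "(\<Sum>m<Suc (Suc N). 1 / (a * l ^ m) powr q) \<le> 1 / (1 - k) * X + X / k"
      using Suc X by (simp add: X_def)
    also have "\<dots> = 1 / (1 - k) * (X / k)" using k by (simp add: field_simps)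
    also have "\<dots> = 1 / (1 - k) / (a * l ^ Suc N) powr q"
      unfolding X[symmetric] by simp
    finally show ?case .
  qed
  show ?thesis
  proof (induction N)
    case 0 then show ?case using k by (simp add: k_def)
  next
    case (Suc N)
    show ?case
    proof (cases "d < a * l ^ N")
      case True
      have "(\<Sum>m<Suc N. if d < a * l ^ m then 1 / (a * l ^ m) powr q else 0)
          \<le> (\<Sum>m<Suc N. 1 / (a * l ^ m) powr q)"
        by (intro sum_mono) auto
      also note full
      also have "1 / (1 - k) / (a * l ^ N) powr q \<le> 1 / (1 - k) / d powr q"
        using True assms k by (intro divide_left_mono powr_mono2) auto
      finally show ?thesis by (simp add: k_def)
    qed (use Suc in simp)
  qed
qed

lemma exists_small_ratio:
  fixes M e :: real
  assumes "0 < e" "0 \<le> M"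
  shows "\<exists>l. 0 < l \<and> l \<le> 1 / 2 \<and> M * l powr e \<le> 1 / 2"
proof -
  define l where "l = min (1 / 2) ((1 / (2 * M + 2)) powr (1 / e))"
  have l: "0 < l" "l \<le> 1 / 2" using assms by (auto simp: l_def)
  have "l powr e \<le> ((1 / (2 * M + 2)) powr (1 / e)) powr e"
    using l assms by (intro powr_mono2) (auto simp: l_def)
  also have "\<dots> = 1 / (2 * M + 2)" using assms by (simp add: powr_powr)
  finally have "M * l powr e \<le> M * (1 / (2 * M + 2))" using assms by (intro mult_left_mono)
  also have "\<dots> \<le> 1 / 2" using assms by (simp add: field_simps)
  finally show ?thesis using l by blast
qed

text \<open>
  Finiteness of \<open>S\<close> is essential here: the half of \<open>S\<close> on the right is absorbed on the left.
\<close>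

lemma ennreal_absorb_half:
  fixes S T :: ennreal
  assumes "S < \<infinity>" "S \<le> ennreal (1 / 2) * S + T"
  shows "S \<le> ennreal 2 * T"
proof (cases T)
  case (real t)
  obtain s where s: "S = ennreal s" "0 \<le> s" using assms(1) by (cases S) auto
  have "ennreal s \<le> ennreal (1 / 2 * s + t)"
    using assms(2) s real by (subst ennreal_plus, simp, simp, subst ennreal_mult) auto
  then have "s \<le> 1 / 2 * s + t" using s real by (subst (asm) ennreal_le_iff) auto
  then have "ennreal s \<le> ennreal (2 * t)" by (intro ennreal_leI) simp
  then show ?thesis using s real by (subst (asm) ennreal_mult) auto
qed (simp add: ennreal_mult_top)

text \<open>
  Rescales the conclusion of the averaging inequality: \<open>v\<close>, \<open>w\<close> and \<open>z\<close> are the powers of the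
  radii that turn the two integrals and the oscillation into the terms of a recursion over scales
  with contraction factor one half.
\<close>

lemma ennreal_affine_bound:
  fixes I J O' :: ennreal
  assumes "I \<le> ennreal g * (ennreal h * J + O')"
    and "0 \<le> v" "0 \<le> g" "0 \<le> h" "0 \<le> w" "0 \<le> K" "0 \<le> z"
    and "v * (g * h) \<le> 1 / 2 * w" "v * g \<le> K * z"
  shows "ennreal v * I \<le> ennreal (1 / 2) * (ennreal w * J) + ennreal K * (ennreal z * O')"
proof -
  have "ennreal v * I \<le> ennreal v * (ennreal g * (ennreal h * J + O'))"
    using assms(1) by (rule mult_left_mono) simp
  also have "\<dots> = ennreal (v * (g * h)) * J + ennreal (v * g) * O'"
    using assms by (simp add: ennreal_mult distrib_left mult.assoc)
  also have "\<dots> \<le> ennreal (1 / 2 * w) * J + ennreal (K * z) * O'"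
    using assms by (intro add_mono mult_right_mono ennreal_leI) auto
  also have "\<dots> = ennreal (1 / 2) * (ennreal w * J) + ennreal K * (ennreal z * O')"
  proof -
    have "ennreal (1 / 2 * w) = ennreal (1 / 2) * ennreal w" "ennreal (K * z) = ennreal K * ennreal z"
      using assms by (simp_all only: ennreal_mult divide_nonneg_nonneg zero_le_one zero_le_numeral)
    then show ?thesis by (simp only: mult.assoc)
  qed
  finally show ?thesis .
qed

lemma open_open_nbhd: "open (open_nbhd S r)"
  unfolding open_nbhd_def by (intro open_Collect_less continuous_intros)

lemma open_nbhdE:
  assumes "x \<in> open_nbhd S r" "S \<noteq> {}"
  obtains z where "z \<in> S" "dist x z < r"
proof -
  have "(INF z\<in>S. dist x z) < r" using assms by (simp add: open_nbhd_def infdist_def)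
  then show thesis using assms(2) that by (subst (asm) cINF_less_iff) auto
qed

context doubling_space
begin

lemma open_nbhd_in_sets [measurable]: "open_nbhd S r \<in> sets \<nu>"
  by (intro open_in_sets open_open_nbhd)

lemma measurable_infdist [measurable]: "(\<lambda>x. infdist x S) \<in> borel_measurable \<nu>"
  unfolding measurable_cong_sets[OF sets_borel refl]
  by (intro borel_measurable_continuous_onI continuous_intros)

text \<open>
  For a fixed pair of points, the scales that see the pair are larger than its distance. On these
  the measure of the ball is at least its value at the distance itself, so that the weights
  \<open>\<rho> powr -q\<close> sum to a multiple of the energy kernel.
\<close>

lemma sum_oscillation_le_energy:
  assumes [measurable]: "u \<in> borel_measurable \<nu>"
    and l: "0 < l" "l < 1" and q: "0 < q" and a: "0 < a"
  shows "(\<Sum>m<N. ennreal (1 / (a * l ^ m) powr q) * oscillation \<nu> p u (a * l ^ m))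
    \<le> ennreal (1 / (1 - l powr q)) * besov_energy \<nu> q p u"
proof -
  interpret sigma_finite_measure \<nu> by (rule sigma_finite)
  define K where "K = 1 / (1 - l powr q)"
  have "l powr q < 1" using l q powr_less_mono2[of q l 1] by auto
  then have K: "0 < K" by (simp add: K_def)
  define P where "P m x y = (if dist x y < a * l ^ m
      then ennreal (\<bar>u x - u y\<bar> powr p / measure \<nu> (ball x (a * l ^ m))) else 0)" for m x y
  have [measurable]: "(\<lambda>z. P m (fst z) (snd z)) \<in> borel_measurable (\<nu> \<Otimes>\<^sub>M \<nu>)" for m
    unfolding P_def by measurable
  have [measurable]: "P m x \<in> borel_measurable \<nu>" for m x
    unfolding P_def by measurable
  define T where "T x y = (\<Sum>m<N. ennreal (1 / (a * l ^ m) powr q) * P m x y)" for x y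
  have [measurable]: "(\<lambda>z. T (fst z) (snd z)) \<in> borel_measurable (\<nu> \<Otimes>\<^sub>M \<nu>)"
    unfolding T_def by measurable
  have [measurable]: "T x \<in> borel_measurable \<nu>" for x
    unfolding T_def by measurable
  have pos: "0 < a * l ^ m" for m using a l by simp
  have T_le: "ennreal (1 / K) * T x y \<le> ennreal (\<bar>u x - u y\<bar> powr p /
      (dist x y powr q * measure \<nu> (ball x (dist x y))))" for x y
  proof (cases "x = y")
    case True
    then show ?thesis by (simp add: T_def P_def)
  next
    case False
    then have d: "0 < dist x y" by simp
    let ?k = "\<bar>u x - u y\<bar> powr p / measure \<nu> (ball x (dist x y))"
    have "T x y \<le> (\<Sum>m<N. ennreal ((if dist x y < a * l ^ m then 1 / (a * l ^ m) powr q else 0) * ?k))"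
      unfolding T_def
    proof (rule sum_mono)
      fix m
      show "ennreal (1 / (a * l ^ m) powr q) * P m x y
        \<le> ennreal ((if dist x y < a * l ^ m then 1 / (a * l ^ m) powr q else 0) * ?k)"
      proof (cases "dist x y < a * l ^ m")
        case True
        have "measure \<nu> (ball x (dist x y)) \<le> measure \<nu> (ball x (a * l ^ m))"
          using True by (intro measure_mono_fmeasurable fmeasurable_ball subset_ball) (auto simp: sets_borel)
        then have "\<bar>u x - u y\<bar> powr p / measure \<nu> (ball x (a * l ^ m)) \<le> ?k"
          using measure_ball_pos[OF d, of x] measure_ball_pos[OF pos, of x] by (intro divide_left_mono) auto
        then have "ennreal (1 / (a * l ^ m) powr q) * P m x y \<le> ennreal (1 / (a * l ^ m) powr q) * ennreal ?k"
          unfolding P_def using True by (auto intro!: mult_left_mono ennreal_leI)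
        then show ?thesis using True by (simp add: ennreal_mult[symmetric])
      qed (simp add: P_def)
    qed
    also have "\<dots> = ennreal ((\<Sum>m<N. if dist x y < a * l ^ m then 1 / (a * l ^ m) powr q else 0) * ?k)"
      unfolding sum_distrib_right by (rule sum_ennreal) auto
    also have "\<dots> \<le> ennreal (K / dist x y powr q * ?k)"
      unfolding K_def using sum_scales_le[OF l q a d] by (intro ennreal_leI mult_right_mono) auto
    finally have "ennreal (1 / K) * T x y \<le> ennreal (1 / K) * ennreal (K / dist x y powr q * ?k)"
      by (rule mult_left_mono) simp
    also have "\<dots> = ennreal (1 / K * (K / dist x y powr q * ?k))"
      using K by (subst ennreal_mult) auto
    also have "1 / K * (K / dist x y powr q * ?k) = \<bar>u x - u y\<bar> powr p / (dist x y powr q * measure \<nu> (ball x (dist x y)))"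
      using K by simp
    finally show ?thesis .
  qed
  \<comment> \<open>The constant is moved across the measurable function \<open>T\<close>, so that the energy enters by monotonicity alone.\<close>
  have "(\<Sum>m<N. ennreal (1 / (a * l ^ m) powr q) * oscillation \<nu> p u (a * l ^ m))
      = (\<integral>\<^sup>+x. (\<integral>\<^sup>+y. T x y \<partial>\<nu>) \<partial>\<nu>)"
    unfolding T_def by (simp add: nn_integral_sum nn_integral_cmult oscillation_def P_def[symmetric])
  also have "\<dots> = ennreal K * (\<integral>\<^sup>+x. (\<integral>\<^sup>+y. ennreal (1 / K) * T x y \<partial>\<nu>) \<partial>\<nu>)"
  proof -
    have "ennreal K * ennreal (1 / K) = 1"
      using K by (subst ennreal_mult[symmetric]) auto
    moreover have "(\<integral>\<^sup>+x. (\<integral>\<^sup>+y. ennreal (1 / K) * T x y \<partial>\<nu>) \<partial>\<nu>) = ennreal (1 / K) * (\<integral>\<^sup>+x. (\<integral>\<^sup>+y. T x y \<partial>\<nu>) \<partial>\<nu>)"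
      by (simp add: nn_integral_cmult)
    ultimately show ?thesis by (metis mult.assoc mult_1)
  qed
  also have "\<dots> \<le> ennreal K * besov_energy \<nu> q p u"
    unfolding besov_energy_def by (intro mult_left_mono nn_integral_mono T_le) simp
  finally show ?thesis by (simp add: K_def)
qed

text \<open>
  On the layer of points whose distance to \<open>S\<close> lies between \<open>a * l ^ Suc m\<close> and \<open>a * l ^ m\<close> the
  weight is comparable with the power of the outer radius.
\<close>

lemma weighted_integral_le_sum:
  assumes [measurable]: "f \<in> borel_measurable \<nu>" and f: "\<And>x. 0 \<le> f x"
    and l: "0 < l" "l < 1" and q: "0 < q" and a: "0 < a"
    and vanish: "\<And>x. infdist x S < a * l ^ N \<Longrightarrow> f x = 0"
  shows "(\<integral>\<^sup>+x\<in>open_nbhd S a. ennreal (f x / infdist x S powr q) \<partial>\<nu>)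
    \<le> ennreal (1 / l powr q) *
        (\<Sum>m<N. ennreal (1 / (a * l ^ m) powr q) * (\<integral>\<^sup>+x\<in>open_nbhd S (a * l ^ m). ennreal (f x) \<partial>\<nu>))"
proof -
  define T where "T m x = ennreal (1 / (a * l ^ m) powr q) * (ennreal (f x) * indicator (open_nbhd S (a * l ^ m)) x)" for m x
  have [measurable]: "T m \<in> borel_measurable \<nu>" for m
    unfolding T_def by measurable
  have "ennreal (f x / infdist x S powr q) * indicator (open_nbhd S a) x
      \<le> ennreal (1 / l powr q) * (\<Sum>m<N. T m x)" for x
  proof (cases "x \<in> open_nbhd S a \<and> a * l ^ N \<le> infdist x S")
    case True
    define M where "M = (LEAST m. a * l ^ m \<le> infdist x S)"
    have M: "a * l ^ M \<le> infdist x S" using LeastI[of "\<lambda>m. a * l ^ m \<le> infdist x S" N] True by (simp add: M_def)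
    have "M \<noteq> 0" using M True by (cases M) (auto simp: open_nbhd_def)
    then obtain m where m: "M = Suc m" by (cases M) auto
    have less: "infdist x S < a * l ^ m"
      using not_less_Least[of m "\<lambda>m. a * l ^ m \<le> infdist x S"] m by (simp add: M_def)
    have "M \<le> N" using Least_le[of "\<lambda>m. a * l ^ m \<le> infdist x S" N] True by (simp add: M_def)
    then have mN: "m < N" using m by simp
    have pos: "0 < a * l ^ Suc m" using a l by simp
    have "f x / infdist x S powr q \<le> f x / (a * l ^ Suc m) powr q"
    proof (intro divide_left_mono powr_mono2 mult_pos_pos)
      show "0 < infdist x S powr q" using pos M m by (auto simp: order_less_le_trans)
    qed (use pos M m q f in auto)
    also have "\<dots> = 1 / l powr q * (1 / (a * l ^ m) powr q * f x)"
      using a l by (simp add: powr_mult)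
    finally have "ennreal (f x / infdist x S powr q) \<le> ennreal \<dots>" by (rule ennreal_leI)
    also have "\<dots> = ennreal (1 / l powr q) * T m x"
      using less f[of x] by (simp add: T_def open_nbhd_def ennreal_mult[symmetric])
    also have "\<dots> \<le> ennreal (1 / l powr q) * (\<Sum>m<N. T m x)"
      using mN by (intro mult_left_mono member_le_sum) auto
    finally show ?thesis using True by simp
  next
    case False
    then show ?thesis using vanish[of x] by (auto simp: indicator_def)
  qed
  then have "(\<integral>\<^sup>+x\<in>open_nbhd S a. ennreal (f x / infdist x S powr q) \<partial>\<nu>)
      \<le> (\<integral>\<^sup>+x. ennreal (1 / l powr q) * (\<Sum>m<N. T m x) \<partial>\<nu>)"
    by (intro nn_integral_mono)
  also have "\<dots> = ennreal (1 / l powr q) * (\<Sum>m<N. \<integral>\<^sup>+x. T m x \<partial>\<nu>)"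
    by (simp add: nn_integral_cmult nn_integral_sum)
  also have "\<dots> = ennreal (1 / l powr q) *
        (\<Sum>m<N. ennreal (1 / (a * l ^ m) powr q) * (\<integral>\<^sup>+x\<in>open_nbhd S (a * l ^ m). ennreal (f x) \<partial>\<nu>))"
    unfolding T_def by (simp add: nn_integral_cmult)
  finally show ?thesis .
qed

end

section \<open>Hardy inequalities near thick and thin sets\<close>

context doubling_space
begin

definition mass :: "real \<Rightarrow> ('a \<Rightarrow> real) \<Rightarrow> 'a set \<Rightarrow> ennreal" where
  "mass p u A = (\<integral>\<^sup>+x\<in>A. ennreal (\<bar>u x\<bar> powr p) \<partial>\<nu>)"

lemma mass_mono: "A \<subseteq> B \<Longrightarrow> mass p u A \<le> mass p u B"
  unfolding mass_def by (intro nn_integral_mono mult_left_mono) (auto simp: indicator_def)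

text \<open>
  Averaging with \<open>A\<close> the neighbourhood of radius \<open>r\<close> and \<open>B\<close> the much thinner one of radius
  \<open>l * r\<close>. Thickness says that \<open>B\<close> still fills the fraction \<open>c * l powr s\<close> of every ball around \<open>S\<close>;
  the ball of radius \<open>2 * r\<close> about a point of \<open>A\<close> contains such a ball of radius \<open>r\<close>.
\<close>

lemma averaging_thick:
  assumes u: "u \<in> borel_measurable \<nu>" and p: "0 < p" and r: "0 < r" and l: "0 < l" and c: "0 < c"
    and S: "S \<noteq> {}"
    and thick: "\<And>z. z \<in> S \<Longrightarrow> c * l powr s * measure \<nu> (ball z r) \<le> measure \<nu> (ball z r \<inter> open_nbhd S (l * r))"
  shows "mass p u (open_nbhd S r) \<le> ennreal (2 powr p * D ^ 2 / (c * l powr s)) *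
      (ennreal D * mass p u (open_nbhd S (l * r)) + oscillation \<nu> p u (2 * r))"
proof -
  have "mass p u (open_nbhd S r) \<le> ennreal (2 powr p / (c * l powr s / D ^ 2)) *
      (ennreal (D * 1) * mass p u (open_nbhd S (l * r)) + oscillation \<nu> p u (2 * r))"
    unfolding mass_def
  proof (rule averaging)
    fix x assume "x \<in> open_nbhd S r"
    then obtain z where z: "z \<in> S" "dist x z < r" using S by (rule open_nbhdE)
    have "measure \<nu> (ball x (2 * r)) \<le> D ^ 2 * measure \<nu> (ball z r)"
      using z r by (intro measure_ball_doubles) (auto simp: dist_commute)
    then have "c * l powr s / D ^ 2 * measure \<nu> (ball x (2 * r))
        \<le> c * l powr s / D ^ 2 * (D ^ 2 * measure \<nu> (ball z r))"
      using c by (intro mult_left_mono) auto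
    also have "\<dots> = c * l powr s * measure \<nu> (ball z r)" using D_ge_1 by simp
    also have "\<dots> \<le> measure \<nu> (ball z r \<inter> open_nbhd S (l * r))" by (rule thick[OF z(1)])
    also have "\<dots> \<le> measure \<nu> (open_nbhd S (l * r) \<inter> ball x (2 * r))"
    proof (intro measure_mono_fmeasurable fmeasurable_inter_ball subsetI)
      fix w assume "w \<in> ball z r \<inter> open_nbhd S (l * r)"
      then show "w \<in> open_nbhd S (l * r) \<inter> ball x (2 * r)"
        using z(2) dist_triangle[of x w z] by auto
    qed (auto intro!: sets.Int open_in_sets open_open_nbhd)
    finally show "c * l powr s / D ^ 2 * measure \<nu> (ball x (2 * r))
        \<le> measure \<nu> (open_nbhd S (l * r) \<inter> ball x (2 * r))" .
  next
    fix y
    show "measure \<nu> (open_nbhd S r \<inter> ball y (2 * r)) \<le> 1 * measure \<nu> (ball y (2 * r))"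
      by (auto intro!: measure_mono_fmeasurable fmeasurable_ball sets.Int open_in_sets open_open_nbhd)
  qed (use u p r c l D_ge_1 in \<open>auto intro!: open_in_sets open_open_nbhd\<close>)
  then show ?thesis by simp
qed

text \<open>
  The roles are exchanged: \<open>A\<close> is the thin neighbourhood, of which every ball of radius \<open>r / 2\<close>
  contains only a fraction of order \<open>l powr t\<close>, whereas the ball of that radius about a point of \<open>A\<close>
  lies entirely in the neighbourhood \<open>B\<close> of radius \<open>r\<close>.
\<close>

lemma averaging_thin:
  assumes u: "u \<in> borel_measurable \<nu>" and p: "0 < p" and r: "0 < r" and l: "0 < l" "l \<le> 1 / 2" and C: "0 \<le> C"
    and S: "S \<noteq> {}"
    and thin: "\<And>z. z \<in> S \<Longrightarrow> measure \<nu> (ball z (2 * r) \<inter> open_nbhd S (l * r)) \<le> C * l powr t * measure \<nu> (ball z (2 * r))"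
  shows "mass p u (open_nbhd S (l * r)) \<le> ennreal (2 powr p) *
      (ennreal (D * (C * D ^ 3 * l powr t)) * mass p u (open_nbhd S r) + oscillation \<nu> p u (r / 2))"
proof -
  have "l * r \<le> r / 2" using l r by simp
  have "mass p u (open_nbhd S (l * r)) \<le> ennreal (2 powr p / 1) *
      (ennreal (D * (C * D ^ 3 * l powr t)) * mass p u (open_nbhd S r) + oscillation \<nu> p u (r / 2))"
    unfolding mass_def
  proof (rule averaging)
    fix x assume "x \<in> open_nbhd S (l * r)"
    then have x: "infdist x S < r / 2" using \<open>l * r \<le> r / 2\<close> by (simp add: open_nbhd_def)
    have "w \<in> open_nbhd S r" if "w \<in> ball x (r / 2)" for w
      using that x infdist_triangle[of w S x] by (simp add: open_nbhd_def dist_commute)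
    then have "open_nbhd S r \<inter> ball x (r / 2) = ball x (r / 2)" by auto
    then show "1 * measure \<nu> (ball x (r / 2)) \<le> measure \<nu> (open_nbhd S r \<inter> ball x (r / 2))" by simp
  next
    fix y
    show "measure \<nu> (open_nbhd S (l * r) \<inter> ball y (r / 2)) \<le> C * D ^ 3 * l powr t * measure \<nu> (ball y (r / 2))"
    proof (cases "open_nbhd S (l * r) \<inter> ball y (r / 2) = {}")
      case False
      then obtain x where x: "x \<in> open_nbhd S (l * r)" "dist y x < r / 2" by auto
      from x(1) S obtain z where z: "z \<in> S" "dist x z < l * r" by (rule open_nbhdE)
      have yz: "dist y z < r" using dist_triangle[of y z x] x(2) z(2) \<open>l * r \<le> r / 2\<close> by simp
      have "measure \<nu> (open_nbhd S (l * r) \<inter> ball y (r / 2)) \<le> measure \<nu> (open_nbhd S (l * r) \<inter> ball z (2 * r))"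
      proof (intro measure_mono_fmeasurable fmeasurable_inter_ball subsetI)
        fix w assume "w \<in> open_nbhd S (l * r) \<inter> ball y (r / 2)"
        then show "w \<in> open_nbhd S (l * r) \<inter> ball z (2 * r)"
          using yz r dist_triangle[of z w y] by (auto simp: dist_commute)
      qed (auto intro!: sets.Int open_in_sets open_open_nbhd)
      also have "\<dots> \<le> C * l powr t * measure \<nu> (ball z (2 * r))"
        using thin[OF z(1)] by (simp add: Int_commute)
      also have "\<dots> \<le> C * l powr t * (D ^ 3 * measure \<nu> (ball y (r / 2)))"
        using yz r C by (intro mult_left_mono measure_ball_doubles) auto
      finally show ?thesis by (simp add: mult_ac)
    qed (use C D_ge_1 in simp)
  qed (use u p r C l D_ge_1 in \<open>auto intro!: open_in_sets open_open_nbhd\<close>)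
  then show ?thesis by simp
qed

text \<open>
  Put \<open>V m = r powr -q * mass p u (open_nbhd S r)\<close> with \<open>r = a * l ^ m\<close>. By averaging,
  \<open>V m\<close> is at most \<open>const * l powr (q - s) * V (Suc m)\<close> plus the oscillation at scale \<open>2 * r\<close>. As
  \<open>s < q\<close>, a small \<open>l\<close> makes the factor at most one half. Since \<open>u\<close> vanishes near \<open>S\<close>, the recursion
  towards smaller scales ends at zero, and adding it up bounds the sum of the \<open>V m\<close> by the energy.
\<close>

lemma hardy_near_thick_set:
  assumes p: "0 < p" and q: "0 < q" and s: "s < q" and c: "0 < c" and a: "0 < a" and S: "S \<noteq> {}"
    and thick: "\<And>z r R. z \<in> S \<Longrightarrow> 0 < r \<Longrightarrow> r \<le> R \<Longrightarrow> R \<le> a \<Longrightarrow>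
      c * (r / R) powr s * measure \<nu> (ball z R) \<le> measure \<nu> (ball z R \<inter> open_nbhd S r)"
  shows "\<exists>K\<ge>0. \<forall>u. u \<in> borel_measurable \<nu> \<longrightarrow> mass p u UNIV < \<infinity> \<longrightarrow> (\<exists>\<delta>>0. \<forall>x. infdist x S < \<delta> \<longrightarrow> u x = 0) \<longrightarrow>
    (\<integral>\<^sup>+x\<in>open_nbhd S a. ennreal (\<bar>u x\<bar> powr p / infdist x S powr q) \<partial>\<nu>)
      \<le> ennreal K * besov_energy \<nu> q p u"
proof -
  obtain l where l: "0 < l" "l \<le> 1 / 2" "2 powr p * D ^ 3 / c * l powr (q - s) \<le> 1 / 2"
    using exists_small_ratio[of "q - s" "2 powr p * D ^ 3 / c"] s c D_ge_1 by auto
  define K where "K = 2 powr p * D ^ 2 * 2 powr q / (c * l powr s)"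
  have K: "0 \<le> K" using c D_ge_1 by (simp add: K_def)
  define K' where "K' = 1 / l powr q * (2 * (K * (1 / (1 - l powr q))))"
  have lq: "l powr q < 1" using l q powr_less_mono2[of q l 1] by auto
  show ?thesis
  proof (intro exI[of _ K'] conjI allI impI)
    show "0 \<le> K'" using K lq by (simp add: K'_def)
    fix u :: "'a \<Rightarrow> real"
    assume u: "u \<in> borel_measurable \<nu>" and fin: "mass p u UNIV < \<infinity>"
      and "\<exists>\<delta>>0. \<forall>x. infdist x S < \<delta> \<longrightarrow> u x = 0"
    then obtain \<delta> where \<delta>: "0 < \<delta>" "\<And>x. infdist x S < \<delta> \<Longrightarrow> u x = 0" by blast
    obtain N where "l ^ N < \<delta> / a"
      using real_arch_pow_inv[of "\<delta> / a" l] \<delta>(1) a l by auto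
    then have N: "a * l ^ N < \<delta>" using a by (simp add: field_simps)
    define V where "V m = ennreal (1 / (a * l ^ m) powr q) * mass p u (open_nbhd S (a * l ^ m))" for m
    define e where "e m = ennreal (1 / (2 * a * l ^ m) powr q) * oscillation \<nu> p u (2 * a * l ^ m)" for m
    have step: "V m \<le> ennreal (1 / 2) * V (Suc m) + ennreal K * e m" for m
    proof -
      define r where "r = a * l ^ m"
      have r: "0 < r" "r \<le> a" using a l by (auto simp: r_def power_le_one)
      have "mass p u (open_nbhd S r) \<le> ennreal (2 powr p * D ^ 2 / (c * l powr s)) *
          (ennreal D * mass p u (open_nbhd S (l * r)) + oscillation \<nu> p u (2 * r))"
      proof (rule averaging_thick[OF u p r(1) l(1) c S])
        fix z assume "z \<in> S"
        then show "c * l powr s * measure \<nu> (ball z r) \<le> measure \<nu> (ball z r \<inter> open_nbhd S (l * r))"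
          using thick[of z "l * r" r] r l by simp
      qed
      then have "ennreal (1 / r powr q) * mass p u (open_nbhd S r)
        \<le> ennreal (1 / 2) * (ennreal (1 / (l * r) powr q) * mass p u (open_nbhd S (l * r)))
          + ennreal K * (ennreal (1 / (2 * r) powr q) * oscillation \<nu> p u (2 * r))"
      proof (rule ennreal_affine_bound)
        have "1 / r powr q * (2 powr p * D ^ 2 / (c * l powr s) * D)
            = (2 powr p * D ^ 3 / c * l powr (q - s)) * (1 / (l * r) powr q)"
          using r l c by (simp add: powr_mult powr_diff power2_eq_square power3_eq_cube field_simps)
        also have "\<dots> \<le> 1 / 2 * (1 / (l * r) powr q)"
          using l(3) by (intro mult_right_mono) auto
        finally show "1 / r powr q * (2 powr p * D ^ 2 / (c * l powr s) * D) \<le> 1 / 2 * (1 / (l * r) powr q)" .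
        show "1 / r powr q * (2 powr p * D ^ 2 / (c * l powr s)) \<le> K * (1 / (2 * r) powr q)"
          using r by (simp add: K_def powr_mult mult_ac)
      qed (use c D_ge_1 K in auto)
      then show ?thesis by (simp add: V_def e_def r_def mult_ac)
    qed
    have VN: "V N = 0"
    proof -
      have "mass p u (open_nbhd S (a * l ^ N)) = (\<integral>\<^sup>+x. 0 \<partial>\<nu>)"
        unfolding mass_def using \<delta>(2) N
        by (intro nn_integral_cong) (auto simp: indicator_def open_nbhd_def)
      then show ?thesis by (simp add: V_def)
    qed
    have Vfin: "V m < \<infinity>" for m
    proof -
      have "mass p u (open_nbhd S (a * l ^ m)) < \<infinity>"
        using mass_mono[of "open_nbhd S (a * l ^ m)" UNIV p u] fin by (auto intro: order_le_less_trans)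
      then show ?thesis by (auto simp: V_def ennreal_mult_less_top)
    qed
    have "(\<Sum>m<N. V m) \<le> (\<Sum>m<N. ennreal (1 / 2) * V (Suc m) + ennreal K * e m)"
      by (intro sum_mono step)
    also have "\<dots> = ennreal (1 / 2) * (\<Sum>m<N. V (Suc m)) + ennreal K * (\<Sum>m<N. e m)"
      by (simp add: sum.distrib sum_distrib_left)
    also have "(\<Sum>m<N. V (Suc m)) \<le> (\<Sum>m<N. V m)"
    proof -
      have "(\<Sum>m<N. V (Suc m)) \<le> V 0 + (\<Sum>m<N. V (Suc m))" by simp
      also have "\<dots> = (\<Sum>m<Suc N. V m)" by (rule sum.lessThan_Suc_shift[symmetric])
      also have "\<dots> = (\<Sum>m<N. V m)" using VN by simp
      finally show ?thesis .
    qed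
    finally have "(\<Sum>m<N. V m) \<le> ennreal (1 / 2) * (\<Sum>m<N. V m) + ennreal K * (\<Sum>m<N. e m)"
      by (simp add: add_right_mono mult_left_mono)
    then have "(\<Sum>m<N. V m) \<le> ennreal 2 * (ennreal K * (\<Sum>m<N. e m))"
      using Vfin by (intro ennreal_absorb_half) (auto simp: less_top)
    also have "(\<Sum>m<N. e m) \<le> ennreal (1 / (1 - l powr q)) * besov_energy \<nu> q p u"
      unfolding e_def using sum_oscillation_le_energy[OF u, where l = l and q = q and a = "2 * a" and N = N and p = p] l q a by simp
    finally have sum: "(\<Sum>m<N. V m) \<le> ennreal 2 * (ennreal K * (ennreal (1 / (1 - l powr q)) * besov_energy \<nu> q p u))"
      by (simp add: mult_left_mono)
    have "(\<integral>\<^sup>+x\<in>open_nbhd S a. ennreal (\<bar>u x\<bar> powr p / infdist x S powr q) \<partial>\<nu>)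
        \<le> ennreal (1 / l powr q) * (\<Sum>m<N. V m)"
      unfolding V_def mass_def
      using u l q a \<delta> N by (intro weighted_integral_le_sum) auto
    also have "\<dots> \<le> ennreal (1 / l powr q) * (ennreal 2 * (ennreal K * (ennreal (1 / (1 - l powr q)) * besov_energy \<nu> q p u)))"
      by (intro mult_left_mono sum) simp
    also have "\<dots> = ennreal K' * besov_energy \<nu> q p u"
      using K lq by (simp only: K'_def ennreal_mult mult_nonneg_nonneg divide_nonneg_nonneg zero_le_one zero_le_numeral powr_ge_zero diff_ge_0_iff_ge less_imp_le mult.assoc)
    finally show "(\<integral>\<^sup>+x\<in>open_nbhd S a. ennreal (\<bar>u x\<bar> powr p / infdist x S powr q) \<partial>\<nu>)
        \<le> ennreal K' * besov_energy \<nu> q p u" .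
  qed
qed

text \<open>
  The recursion now runs towards larger scales: \<open>V (Suc m)\<close> is at most
  \<open>const * l powr (t - q) * V m\<close> plus an oscillation, and \<open>q < t\<close> makes it a contraction. It ends at
  the fixed scale \<open>a\<close>, which is why the whole integral of \<open>u\<close> remains on the right.
\<close>

lemma hardy_near_thin_set:
  assumes p: "0 < p" and q: "0 < q" and t: "q < t" and C: "0 \<le> C" and a: "0 < a" and S: "S \<noteq> {}"
    and thin: "\<And>z r R. z \<in> S \<Longrightarrow> 0 < r \<Longrightarrow> r \<le> R \<Longrightarrow> R \<le> 2 * a \<Longrightarrow>
      measure \<nu> (ball z R \<inter> open_nbhd S r) \<le> C * (r / R) powr t * measure \<nu> (ball z R)"
  shows "\<exists>K\<ge>0. \<forall>u. u \<in> borel_measurable \<nu> \<longrightarrow> mass p u UNIV < \<infinity> \<longrightarrow> (\<exists>\<delta>>0. \<forall>x. infdist x S < \<delta> \<longrightarrow> u x = 0) \<longrightarrow>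
    (\<integral>\<^sup>+x\<in>open_nbhd S a. ennreal (\<bar>u x\<bar> powr p / infdist x S powr q) \<partial>\<nu>)
      \<le> ennreal K * (besov_energy \<nu> q p u + mass p u UNIV)"
proof -
  obtain l where l: "0 < l" "l \<le> 1 / 2" "2 powr p * D ^ 4 * C * l powr (t - q) \<le> 1 / 2"
    using exists_small_ratio[of "t - q" "2 powr p * D ^ 4 * C"] t C D_ge_1 by auto
  define K where "K = 2 powr p / (2 * l) powr q"
  have K: "0 \<le> K" by (simp add: K_def)
  have lq: "l powr q < 1" using l q powr_less_mono2[of q l 1] by auto
  define K1 where "K1 = max (1 / a powr q) (K * (1 / (1 - l powr q)))"
  have K1: "0 \<le> K1" by (simp add: K1_def le_max_iff_disj)
  define K' where "K' = 1 / l powr q * (2 * K1)"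
  show ?thesis
  proof (intro exI[of _ K'] conjI allI impI)
    show "0 \<le> K'" using K1 by (simp add: K'_def)
    fix u :: "'a \<Rightarrow> real"
    assume u: "u \<in> borel_measurable \<nu>" and fin: "mass p u UNIV < \<infinity>"
      and "\<exists>\<delta>>0. \<forall>x. infdist x S < \<delta> \<longrightarrow> u x = 0"
    then obtain \<delta> where \<delta>: "0 < \<delta>" "\<And>x. infdist x S < \<delta> \<Longrightarrow> u x = 0" by blast
    obtain N where "l ^ N < \<delta> / a"
      using real_arch_pow_inv[of "\<delta> / a" l] \<delta>(1) a l by auto
    then have N: "a * l ^ N < \<delta>" using a by (simp add: field_simps)
    define V where "V m = ennreal (1 / (a * l ^ m) powr q) * mass p u (open_nbhd S (a * l ^ m))" for m
    define e where "e m = ennreal (1 / (a / 2 * l ^ m) powr q) * oscillation \<nu> p u (a / 2 * l ^ m)" for m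
    have step: "V (Suc m) \<le> ennreal (1 / 2) * V m + ennreal K * e m" for m
    proof -
      define r where "r = a * l ^ m"
      have r: "0 < r" "r \<le> a" using a l by (auto simp: r_def power_le_one)
      have "mass p u (open_nbhd S (l * r)) \<le> ennreal (2 powr p) *
        (ennreal (D * (C * D ^ 3 * l powr t)) * mass p u (open_nbhd S r) + oscillation \<nu> p u (r / 2))"
      proof (rule averaging_thin[OF u p r(1) l(1,2) C S])
        fix z assume "z \<in> S"
        then have "measure \<nu> (ball z (2 * r) \<inter> open_nbhd S (l * r))
            \<le> C * (l * r / (2 * r)) powr t * measure \<nu> (ball z (2 * r))"
          using thin[of z "l * r" "2 * r"] r l by simp
        also have "\<dots> \<le> C * l powr t * measure \<nu> (ball z (2 * r))"
          using r l C t q by (intro mult_right_mono mult_left_mono powr_mono2) auto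
        finally show "measure \<nu> (ball z (2 * r) \<inter> open_nbhd S (l * r)) \<le> C * l powr t * measure \<nu> (ball z (2 * r))" .
      qed
      then have "ennreal (1 / (l * r) powr q) * mass p u (open_nbhd S (l * r))
        \<le> ennreal (1 / 2) * (ennreal (1 / r powr q) * mass p u (open_nbhd S r))
          + ennreal K * (ennreal (1 / (r / 2) powr q) * oscillation \<nu> p u (r / 2))"
      proof (rule ennreal_affine_bound)
        have "1 / (l * r) powr q * (2 powr p * (D * (C * D ^ 3 * l powr t)))
            = (2 powr p * D ^ 4 * C * l powr (t - q)) * (1 / r powr q)"
          using r l by (simp add: powr_mult powr_diff eval_nat_numeral field_simps)
        also have "\<dots> \<le> 1 / 2 * (1 / r powr q)"
          using l(3) by (intro mult_right_mono) auto
        finally show "1 / (l * r) powr q * (2 powr p * (D * (C * D ^ 3 * l powr t))) \<le> 1 / 2 * (1 / r powr q)" .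
        show "1 / (l * r) powr q * 2 powr p \<le> K * (1 / (r / 2) powr q)"
          using r l by (simp add: K_def powr_mult powr_divide mult_ac)
      qed (use C D_ge_1 K in auto)
      then show ?thesis by (simp add: V_def e_def r_def mult_ac)
    qed
    have Vfin: "V m < \<infinity>" for m
    proof -
      have "mass p u (open_nbhd S (a * l ^ m)) < \<infinity>"
        using mass_mono[of "open_nbhd S (a * l ^ m)" UNIV p u] fin by (auto intro: order_le_less_trans)
      then show ?thesis by (auto simp: V_def ennreal_mult_less_top)
    qed
    have "(\<Sum>m<N. V m) \<le> (\<Sum>m<Suc N. V m)" by simp
    also have "\<dots> = V 0 + (\<Sum>m<N. V (Suc m))" by (rule sum.lessThan_Suc_shift)
    also have "(\<Sum>m<N. V (Suc m)) \<le> (\<Sum>m<N. ennreal (1 / 2) * V m + ennreal K * e m)"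
      by (intro sum_mono step)
    also have "\<dots> = ennreal (1 / 2) * (\<Sum>m<N. V m) + ennreal K * (\<Sum>m<N. e m)"
      by (simp add: sum.distrib sum_distrib_left)
    finally have "(\<Sum>m<N. V m) \<le> ennreal (1 / 2) * (\<Sum>m<N. V m) + (V 0 + ennreal K * (\<Sum>m<N. e m))"
      by (simp add: add_left_mono add_ac)
    then have "(\<Sum>m<N. V m) \<le> ennreal 2 * (V 0 + ennreal K * (\<Sum>m<N. e m))"
      using Vfin by (intro ennreal_absorb_half) (auto simp: less_top)
    also have "V 0 + ennreal K * (\<Sum>m<N. e m) \<le> ennreal K1 * (besov_energy \<nu> q p u + mass p u UNIV)"
    proof -
      have "V 0 \<le> ennreal K1 * mass p u UNIV"
        unfolding V_def by (intro mult_mono ennreal_leI mass_mono) (auto simp: K1_def)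
      moreover have "ennreal K * (\<Sum>m<N. e m) \<le> ennreal K1 * besov_energy \<nu> q p u"
      proof -
        have "(\<Sum>m<N. e m) \<le> ennreal (1 / (1 - l powr q)) * besov_energy \<nu> q p u"
          unfolding e_def using sum_oscillation_le_energy[OF u, where l = l and q = q and a = "a / 2" and N = N and p = p] l q a by simp
        then have "ennreal K * (\<Sum>m<N. e m) \<le> ennreal K * (ennreal (1 / (1 - l powr q)) * besov_energy \<nu> q p u)"
          by (rule mult_left_mono) simp
        also have "\<dots> = ennreal (K * (1 / (1 - l powr q))) * besov_energy \<nu> q p u"
          using K lq by (subst ennreal_mult) (auto simp: mult.assoc)
        also have "\<dots> \<le> ennreal K1 * besov_energy \<nu> q p u"
          by (intro mult_right_mono ennreal_leI) (auto simp: K1_def)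
        finally show ?thesis .
      qed
      ultimately show ?thesis unfolding distrib_left by (metis add.commute add_mono)
    qed
    finally have sum: "(\<Sum>m<N. V m) \<le> ennreal 2 * (ennreal K1 * (besov_energy \<nu> q p u + mass p u UNIV))"
      by (simp add: mult_left_mono)
    have "(\<integral>\<^sup>+x\<in>open_nbhd S a. ennreal (\<bar>u x\<bar> powr p / infdist x S powr q) \<partial>\<nu>)
        \<le> ennreal (1 / l powr q) * (\<Sum>m<N. V m)"
      unfolding V_def mass_def
      using u l q a \<delta> N by (intro weighted_integral_le_sum) auto
    also have "\<dots> \<le> ennreal (1 / l powr q) * (ennreal 2 * (ennreal K1 * (besov_energy \<nu> q p u + mass p u UNIV)))"
      by (intro mult_left_mono sum) simp
    also have "\<dots> = ennreal K' * (besov_energy \<nu> q p u + mass p u UNIV)"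
      using K1 by (simp only: K'_def ennreal_mult mult_nonneg_nonneg divide_nonneg_nonneg zero_le_one zero_le_numeral powr_ge_zero mult.assoc)
    finally show "(\<integral>\<^sup>+x\<in>open_nbhd S a. ennreal (\<bar>u x\<bar> powr p / infdist x S powr q) \<partial>\<nu>)
        \<le> ennreal K' * (besov_energy \<nu> q p u + mass p u UNIV)" .
  qed
qed

text \<open>
  The same averaging at one large scale: \<open>A\<close> is the bounded set, \<open>B\<close> the ball, and \<open>\<rho>\<close> is so large
  that the ball of radius \<open>\<rho>\<close> about any point of \<open>\<Omega>\<close> contains \<open>B\<close>.
\<close>

lemma poincare_from_ball:
  assumes p: "0 < p" and q: "0 < q" and \<Omega>: "\<Omega> \<in> sets \<nu>" "bounded \<Omega>" and b: "0 < b"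
  shows "\<exists>K\<ge>0. \<forall>u. u \<in> borel_measurable \<nu> \<longrightarrow> mass p u \<Omega> \<le> ennreal K * (besov_energy \<nu> q p u + mass p u (ball z b))"
proof -
  obtain M where M: "\<And>x. x \<in> \<Omega> \<Longrightarrow> dist z x \<le> M"
    using bounded_any_center[of \<Omega> z] \<Omega>(2) by auto
  define \<rho> where "\<rho> = max M 0 + b"
  have \<rho>: "0 < \<rho>" using b by (simp add: \<rho>_def)
  obtain n where n: "(max M 0 + \<rho>) / b < 2 ^ n"
    using real_arch_pow[of 2 "(max M 0 + \<rho>) / b"] by auto
  define k where "k = 1 - (1 / 2) powr q"
  have k: "0 < k" using q powr_less_mono2[of q "1 / 2" 1] by (simp add: k_def)
  define K where "K = 2 powr p * D ^ n * max D (\<rho> powr q / k)"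
  have K: "0 \<le> K" using D_ge_1 by (simp add: K_def le_max_iff_disj)
  show ?thesis
  proof (intro exI[of _ K] conjI allI impI K)
    fix u :: "'a \<Rightarrow> real"
    assume u: "u \<in> borel_measurable \<nu>"
    have osc: "oscillation \<nu> p u \<rho> \<le> ennreal (\<rho> powr q / k) * besov_energy \<nu> q p u"
    proof -
      have "ennreal (\<rho> powr q) * (ennreal (1 / \<rho> powr q) * oscillation \<nu> p u \<rho>)
          \<le> ennreal (\<rho> powr q) * (ennreal (1 / k) * besov_energy \<nu> q p u)"
        using sum_oscillation_le_energy[OF u, where l = "1 / 2" and q = q and a = \<rho> and N = 1 and p = p] q \<rho>
        by (intro mult_left_mono) (auto simp: k_def)
      moreover have "ennreal (\<rho> powr q) * ennreal (1 / \<rho> powr q) = 1"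
        using \<rho> by (subst ennreal_mult[symmetric]) auto
      moreover have "ennreal (\<rho> powr q) * ennreal (1 / k) = ennreal (\<rho> powr q / k)"
        using k by (subst ennreal_mult[symmetric]) auto
      ultimately show ?thesis by (metis mult.assoc mult_1)
    qed
    have "mass p u \<Omega> \<le> ennreal (2 powr p / (1 / D ^ n)) * (ennreal (D * 1) * mass p u (ball z b) + oscillation \<nu> p u \<rho>)"
      unfolding mass_def
    proof (rule averaging)
      fix x assume x: "x \<in> \<Omega>"
      have "measure \<nu> (ball x \<rho>) \<le> D ^ n * measure \<nu> (ball z b)"
        using M[OF x] n b by (intro measure_ball_doubles) (auto simp: field_simps)
      moreover have "ball z b \<inter> ball x \<rho> = ball z b"
      proof -
        have "w \<in> ball x \<rho>" if "w \<in> ball z b" for w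
          using that M[OF x] dist_triangle[of x w z] by (auto simp: \<rho>_def dist_commute)
        then show ?thesis by auto
      qed
      ultimately show "1 / D ^ n * measure \<nu> (ball x \<rho>) \<le> measure \<nu> (ball z b \<inter> ball x \<rho>)"
        using D_ge_1 by (simp add: field_simps)
    next
      fix y
      show "measure \<nu> (\<Omega> \<inter> ball y \<rho>) \<le> 1 * measure \<nu> (ball y \<rho>)"
        by (simp, intro measure_mono_fmeasurable fmeasurable_ball sets.Int \<Omega>(1) open_in_sets) auto
    qed (use u p \<rho> \<Omega> D_ge_1 in \<open>auto intro!: open_in_sets\<close>)
    also have "\<dots> \<le> ennreal (2 powr p * D ^ n) * (ennreal (max D (\<rho> powr q / k)) * mass p u (ball z b)
        + ennreal (max D (\<rho> powr q / k)) * besov_energy \<nu> q p u)"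
    proof -
      have "oscillation \<nu> p u \<rho> \<le> ennreal (max D (\<rho> powr q / k)) * besov_energy \<nu> q p u"
        by (rule order_trans[OF osc]) (intro mult_right_mono ennreal_leI, auto)
      then show ?thesis
        by (intro mult_mono add_mono ennreal_leI) auto
    qed
    also have "\<dots> = ennreal K * (besov_energy \<nu> q p u + mass p u (ball z b))"
      using D_ge_1 unfolding K_def
      by (subst ennreal_mult[of _ "max D (\<rho> powr q / k)"]) (auto simp: distrib_left mult.assoc add.commute le_max_iff_disj)
    finally show "mass p u \<Omega> \<le> ennreal K * (besov_energy \<nu> q p u + mass p u (ball z b))" .
  qed
qed

end

section \<open>Assouad codimensions and compactly supported Lipschitz functions\<close>

lemma doubling_measureD:
  assumes "doubling_measure \<nu>"
  obtains D where "doubling_space \<nu> D"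
proof -
  obtain C :: real where C: "1 \<le> C" and sets: "sets \<nu> = sets borel"
    and dbl: "\<And>x r. r > 0 \<Longrightarrow> 0 < emeasure \<nu> (ball x (2 * r)) \<and>
        emeasure \<nu> (ball x (2 * r)) \<le> ennreal C * emeasure \<nu> (ball x r) \<and>
        ennreal C * emeasure \<nu> (ball x r) < \<infinity>"
    using assms unfolding doubling_measure_def by blast
  have fin: "emeasure \<nu> (ball x r) < \<infinity>" for x r
  proof (cases "0 < r")
    case True
    have "1 * emeasure \<nu> (ball x r) \<le> ennreal C * emeasure \<nu> (ball x r)"
      using C by (intro mult_right_mono) auto
    then show ?thesis using dbl[OF True, of x] by (simp add: order_le_less_trans)
  qed (simp add: ball_empty)
  have eq: "emeasure \<nu> (ball x r) = ennreal (measure \<nu> (ball x r))" for x r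
    using fin[of x r] by (simp add: emeasure_eq_ennreal_measure)
  have "doubling_space \<nu> C"
  proof
    fix x r assume r: "0 < (r::real)"
    show "0 < measure \<nu> (ball x r)"
      using dbl[of "r / 2" x] r by (simp add: eq)
    have "ennreal (measure \<nu> (ball x (2 * r))) \<le> ennreal (C * measure \<nu> (ball x r))"
      using dbl[OF r, of x] C by (simp add: eq ennreal_mult)
    then show "measure \<nu> (ball x (2 * r)) \<le> C * measure \<nu> (ball x r)"
      using C by (subst (asm) ennreal_le_iff) auto
  qed (use sets C fin in auto)
  then show thesis using that by blast
qed

text \<open>
  Turns the restriction of the radii to less than a diameter, possibly infinite, into a bound by a
  real number.
\<close>

lemma exists_radius_less:
  assumes "0 < (e::ennreal)"
  shows "\<exists>a>0. ennreal a < e"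
proof -
  obtain y where y: "0 < y" "y < e" using dense[OF assms] by blast
  then obtain a where "y = ennreal a" by (cases y) auto
  then show ?thesis using y by (intro exI[of _ a]) auto
qed

lemma ediam_UNIV_pos:
  fixes x y :: "'a::metric_space"
  assumes "x \<noteq> y"
  shows "0 < ediam (UNIV :: 'a set)"
proof -
  have "0 < ennreal (dist x y)" using assms by simp
  also have "\<dots> \<le> ediam (UNIV :: 'a set)"
    unfolding ediam_def by (intro SUP_upper2[of x] SUP_upper2[of y]) auto
  finally show ?thesis .
qed

context doubling_space
begin

lemma upper_assouad_codim_lessD:
  assumes "upper_assouad_codim \<nu> S < ennreal q"
  shows "\<exists>s c a. s < q \<and> 0 < c \<and> 0 < a \<and> (\<forall>z\<in>S. \<forall>r R. 0 < r \<longrightarrow> r \<le> R \<longrightarrow> R \<le> a \<longrightarrow>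
    c * (r / R) powr s * measure \<nu> (ball z R) \<le> measure \<nu> (ball z R \<inter> open_nbhd S r))"
proof -
  from assms obtain s c :: real where s: "0 \<le> s" "ennreal s < ennreal q" and c: "0 < c"
    and bound: "\<And>z r R. z \<in> S \<Longrightarrow> 0 < r \<Longrightarrow> r \<le> R \<Longrightarrow> ediam S = 0 \<or> ennreal R < ediam S \<Longrightarrow>
        measure \<nu> (ball z R \<inter> open_nbhd S r) / measure \<nu> (ball z R) \<ge> c * (r / R) powr s"
    unfolding upper_assouad_codim_def Inf_less_iff by blast
  obtain a where a: "0 < a" "ediam S = 0 \<or> ennreal a < ediam S"
    using exists_radius_less[of "ediam S"] by (metis not_gr_zero zero_less_one)
  show ?thesis
  proof (intro exI conjI ballI allI impI)
    show "s < q" using s by (simp add: ennreal_less_iff)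
    fix z r R assume z: "z \<in> S" and r: "0 < r" "r \<le> R" and R: "R \<le> a"
    have "ennreal R \<le> ennreal a" using R by (rule ennreal_leI)
    then have "ediam S = 0 \<or> ennreal R < ediam S" using a(2) by (auto intro: order_le_less_trans)
    then show "c * (r / R) powr s * measure \<nu> (ball z R) \<le> measure \<nu> (ball z R \<inter> open_nbhd S r)"
      using bound[OF z r] measure_ball_pos[of R z] r by (simp add: pos_le_divide_eq)
  qed (use c a in auto)
qed

lemma lower_assouad_codim_greaterD:
  assumes "ennreal q < lower_assouad_codim \<nu> S" and q: "0 \<le> q" and diam: "0 < ediam (UNIV :: 'a set)"
  shows "\<exists>t C a. q < t \<and> 0 \<le> C \<and> 0 < a \<and> (\<forall>z\<in>S. \<forall>r R. 0 < r \<longrightarrow> r \<le> R \<longrightarrow> R \<le> 2 * a \<longrightarrow>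
    measure \<nu> (ball z R \<inter> open_nbhd S r) \<le> C * (r / R) powr t * measure \<nu> (ball z R))"
proof -
  from assms(1) obtain t C :: real where t: "0 \<le> t" "ennreal q < ennreal t" and C: "1 \<le> C"
    and bound: "\<And>z r R. z \<in> S \<Longrightarrow> 0 < r \<Longrightarrow> r \<le> R \<Longrightarrow> ennreal R < ediam (UNIV :: 'a set) \<Longrightarrow>
        measure \<nu> (ball z R \<inter> open_nbhd S r) / measure \<nu> (ball z R) \<le> C * (r / R) powr t"
    unfolding lower_assouad_codim_def less_Sup_iff by blast
  obtain a where a: "0 < a" "ennreal a < ediam (UNIV :: 'a set)"
    using exists_radius_less[OF diam] by blast
  show ?thesis
  proof (intro exI conjI ballI allI impI)
    show "q < t" using t q by (simp add: ennreal_less_iff)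
    show "0 < a / 2" using a by simp
    fix z r R assume z: "z \<in> S" and r: "0 < r" "r \<le> R" and R: "R \<le> 2 * (a / 2)"
    have "ennreal R \<le> ennreal a" using R by (intro ennreal_leI) simp
    then have "ennreal R < ediam (UNIV :: 'a set)" using a(2) by (rule order_le_less_trans)
    then show "measure \<nu> (ball z R \<inter> open_nbhd S r) \<le> C * (r / R) powr t * measure \<nu> (ball z R)"
      using bound[OF z r] measure_ball_pos[of R z] r by (simp add: pos_divide_le_eq)
  qed (use C in auto)
qed

lemma Lip_c_measurable: "u \<in> Lip_c \<Omega> \<Longrightarrow> u \<in> borel_measurable \<nu>"
  unfolding measurable_cong_sets[OF sets_borel refl]
  by (auto simp: Lip_c_def intro!: borel_measurable_continuous_onI dest: lipschitz_on_continuous_on)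

lemma Lip_c_vanishes: "u \<in> Lip_c \<Omega> \<Longrightarrow> x \<notin> \<Omega> \<Longrightarrow> u x = 0"
  using closure_subset[of "{x. u x \<noteq> 0}"] by (auto simp: Lip_c_def)

text \<open>
  The support is compact and disjoint from the closed set, so that their distance is positive.
\<close>

lemma Lip_c_vanishes_near:
  assumes u: "u \<in> Lip_c \<Omega>" and S: "closed S" "S \<inter> \<Omega> = {}" "S \<noteq> {}"
  shows "\<exists>\<delta>>0. \<forall>x. infdist x S < \<delta> \<longrightarrow> u x = 0"
proof -
  let ?K = "closure {x. u x \<noteq> 0}"
  have K: "compact ?K" "?K \<inter> S = {}" using u S(2) by (auto simp: Lip_c_def)
  have "\<exists>\<delta>>0. \<forall>x\<in>?K. \<delta> \<le> infdist x S"
  proof (cases "?K = {}")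
    case False
    have "continuous_on ?K (\<lambda>x. infdist x S)" by (intro continuous_intros)
    then obtain x where x: "x \<in> ?K" "\<And>y. y \<in> ?K \<Longrightarrow> infdist x S \<le> infdist y S"
      using continuous_attains_inf[OF K(1) False] by blast
    moreover have "0 < infdist x S"
      using K(2) x(1) by (intro infdist_pos_not_in_closed S) auto
    ultimately show ?thesis by blast
  qed (auto intro: exI[of _ 1])
  then obtain \<delta> where \<delta>: "0 < \<delta>" "\<And>x. x \<in> ?K \<Longrightarrow> \<delta> \<le> infdist x S" by blast
  have "u x = 0" if "infdist x S < \<delta>" for x
    using \<delta>(2)[of x] that closure_subset[of "{x. u x \<noteq> 0}"] by auto
  then show ?thesis using \<delta>(1) by blast
qed

lemma Lip_c_mass_finite:
  assumes u: "u \<in> Lip_c \<Omega>" and p: "0 < p"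
  shows "mass p u UNIV < \<infinity>"
proof -
  let ?K = "closure {x. u x \<noteq> 0}"
  have K: "compact ?K" using u by (auto simp: Lip_c_def)
  have cont: "continuous_on UNIV u"
    using u by (auto simp: Lip_c_def intro: lipschitz_on_continuous_on)
  have "bounded (u ` ?K)"
    by (intro compact_imp_bounded compact_continuous_image K continuous_on_subset[OF cont]) auto
  then obtain B where B: "\<And>x. x \<in> ?K \<Longrightarrow> \<bar>u x\<bar> \<le> B" by (auto simp: bounded_iff)
  fix x0 :: 'a
  obtain M where M: "\<And>x. x \<in> ?K \<Longrightarrow> dist x0 x \<le> M"
    using compact_imp_bounded[OF K] bounded_any_center[of ?K x0] by blast
  have "mass p u UNIV \<le> (\<integral>\<^sup>+x. ennreal (B powr p) * indicator (ball x0 (M + 1)) x \<partial>\<nu>)"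
    unfolding mass_def
  proof (rule nn_integral_mono)
    fix x
    show "ennreal (\<bar>u x\<bar> powr p) * indicator UNIV x \<le> ennreal (B powr p) * indicator (ball x0 (M + 1)) x"
    proof (cases "u x = 0")
      case False
      then have x: "x \<in> ?K" using closure_subset[of "{x. u x \<noteq> 0}"] by auto
      then have "dist x0 x \<le> M" by (rule M)
      then have "x \<in> ball x0 (M + 1)" by simp
      moreover have "\<bar>u x\<bar> powr p \<le> B powr p" using B[OF x] p by (intro powr_mono2) auto
      ultimately show ?thesis by (simp add: ennreal_leI)
    qed simp
  qed
  also have "\<dots> = ennreal (B powr p) * emeasure \<nu> (ball x0 (M + 1))"
    by (subst nn_integral_cmult_indicator) (auto intro: open_in_sets)
  also have "\<dots> < \<infinity>" using emeasure_ball_finite[of x0 "M + 1"] by (simp add: ennreal_mult_less_top)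
  finally show ?thesis .
qed

text \<open>
  At distance at least \<open>a\<close> from \<open>S\<close> the weight is bounded.
\<close>

lemma weighted_le_near_plus_mass:
  assumes [measurable]: "u \<in> borel_measurable \<nu>" and q: "0 < q" and a: "0 < a"
  shows "(\<integral>\<^sup>+x. ennreal (\<bar>u x\<bar> powr p / infdist x S powr q) \<partial>\<nu>)
    \<le> (\<integral>\<^sup>+x\<in>open_nbhd S a. ennreal (\<bar>u x\<bar> powr p / infdist x S powr q) \<partial>\<nu>)
      + ennreal (1 / a powr q) * mass p u UNIV"
proof -
  have "ennreal (\<bar>u x\<bar> powr p / infdist x S powr q)
      \<le> ennreal (\<bar>u x\<bar> powr p / infdist x S powr q) * indicator (open_nbhd S a) x
        + ennreal (1 / a powr q) * (ennreal (\<bar>u x\<bar> powr p) * indicator UNIV x)" for x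
  proof (cases "x \<in> open_nbhd S a")
    case False
    then have "a \<le> infdist x S" by (simp add: open_nbhd_def)
    then have "\<bar>u x\<bar> powr p / infdist x S powr q \<le> \<bar>u x\<bar> powr p / a powr q"
      using a q by (intro divide_left_mono powr_mono2 mult_pos_pos) auto
    then show ?thesis using False by (simp add: ennreal_mult[symmetric] ennreal_leI)
  qed simp
  then have "(\<integral>\<^sup>+x. ennreal (\<bar>u x\<bar> powr p / infdist x S powr q) \<partial>\<nu>)
    \<le> (\<integral>\<^sup>+x. ennreal (\<bar>u x\<bar> powr p / infdist x S powr q) * indicator (open_nbhd S a) x
        + ennreal (1 / a powr q) * (ennreal (\<bar>u x\<bar> powr p) * indicator UNIV x) \<partial>\<nu>)"
    by (intro nn_integral_mono)
  also have "\<dots> = (\<integral>\<^sup>+x\<in>open_nbhd S a. ennreal (\<bar>u x\<bar> powr p / infdist x S powr q) \<partial>\<nu>)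
      + ennreal (1 / a powr q) * mass p u UNIV"
    unfolding mass_def by (subst nn_integral_add) (simp_all add: nn_integral_cmult)
  finally show ?thesis .
qed

lemma mass_near_le_weighted:
  assumes [measurable]: "u \<in> borel_measurable \<nu>" and q: "0 < q" and a: "0 < a"
    and \<delta>: "0 < \<delta>" "\<And>x. infdist x S < \<delta> \<Longrightarrow> u x = 0"
  shows "mass p u (open_nbhd S a)
    \<le> ennreal (a powr q) * (\<integral>\<^sup>+x\<in>open_nbhd S a. ennreal (\<bar>u x\<bar> powr p / infdist x S powr q) \<partial>\<nu>)"
proof -
  have "ennreal (\<bar>u x\<bar> powr p) * indicator (open_nbhd S a) x
      \<le> ennreal (a powr q) * (ennreal (\<bar>u x\<bar> powr p / infdist x S powr q) * indicator (open_nbhd S a) x)" for x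
  proof (cases "x \<in> open_nbhd S a \<and> u x \<noteq> 0")
    case True
    then have "\<not> infdist x S < \<delta>" using \<delta>(2) by blast
    then have d: "0 < infdist x S" "infdist x S \<le> a"
      using \<delta>(1) True by (auto simp: open_nbhd_def)
    then have "\<bar>u x\<bar> powr p * infdist x S powr q \<le> \<bar>u x\<bar> powr p * a powr q"
      using q by (intro mult_left_mono powr_mono2) auto
    then have "\<bar>u x\<bar> powr p \<le> a powr q * (\<bar>u x\<bar> powr p / infdist x S powr q)"
      using d by (simp add: field_simps)
    then show ?thesis using True by (simp add: ennreal_mult[symmetric] ennreal_leI)
  qed auto
  then show ?thesis
    unfolding mass_def by (subst nn_integral_cmult[symmetric]) (auto intro!: nn_integral_mono)
qed

text \<open>
  The complement of \<open>\<Omega>\<close> is thick, so that the weighted integral near it is bounded by the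
  energy. A ball centred in the complement lies in this neighbourhood, and the Poincare inequality
  carries the bound from that ball to all of the bounded set \<open>\<Omega>\<close>. Away from the complement the weight is
  bounded, and the unweighted integral suffices.
\<close>

lemma hardy_thick_complement:
  assumes p: "0 < p" and q: "0 < q" and \<Omega>: "open \<Omega>" "bounded \<Omega>" "- \<Omega> \<noteq> {}"
    and codim: "upper_assouad_codim \<nu> (- \<Omega>) < ennreal q"
  shows "\<exists>K\<ge>0. \<forall>u\<in>Lip_c \<Omega>.
    mass p u UNIV \<le> ennreal K * besov_energy \<nu> q p u \<and>
    (\<integral>\<^sup>+x. ennreal (\<bar>u x\<bar> powr p / infdist x (- \<Omega>) powr q) \<partial>\<nu>) \<le> ennreal K * besov_energy \<nu> q p u"
proof -
  obtain s c a where s: "s < q" and c: "0 < c" and a: "0 < a"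
    and thick: "\<And>z r R. z \<in> - \<Omega> \<Longrightarrow> 0 < r \<Longrightarrow> r \<le> R \<Longrightarrow> R \<le> a \<Longrightarrow>
      c * (r / R) powr s * measure \<nu> (ball z R) \<le> measure \<nu> (ball z R \<inter> open_nbhd (- \<Omega>) r)"
    using upper_assouad_codim_lessD[OF codim] by blast
  define near where "near u = (\<integral>\<^sup>+x\<in>open_nbhd (- \<Omega>) a. ennreal (\<bar>u x\<bar> powr p / infdist x (- \<Omega>) powr q) \<partial>\<nu>)" for u
  obtain K1 where K1: "0 \<le> K1" and near: "\<And>u. u \<in> borel_measurable \<nu> \<Longrightarrow> mass p u UNIV < \<infinity> \<Longrightarrow>
      \<exists>\<delta>>0. \<forall>x. infdist x (- \<Omega>) < \<delta> \<longrightarrow> u x = 0 \<Longrightarrow> near u \<le> ennreal K1 * besov_energy \<nu> q p u"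
    using hardy_near_thick_set[OF p q s c a \<Omega>(3) thick] unfolding near_def by blast
  obtain z where z: "z \<in> - \<Omega>" using \<Omega>(3) by blast
  obtain K2 where K2: "0 \<le> K2" and poincare: "\<And>u. u \<in> borel_measurable \<nu> \<Longrightarrow>
      mass p u \<Omega> \<le> ennreal K2 * (besov_energy \<nu> q p u + mass p u (ball z a))"
    using poincare_from_ball[OF p q open_in_sets[OF \<Omega>(1)] \<Omega>(2) a, of z] by blast
  define K3 where "K3 = K2 * (1 + a powr q * K1)"
  define K where "K = max K3 (K1 + 1 / a powr q * K3)"
  have K3: "0 \<le> K3" using K1 K2 by (simp add: K3_def)
  show ?thesis
  proof (intro exI[of _ K] conjI ballI)
    show "0 \<le> K" using K3 by (simp add: K_def le_max_iff_disj)
    fix u assume u: "u \<in> Lip_c \<Omega>"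
    note um = Lip_c_measurable[OF u]
    have "closed (- \<Omega>)" using \<Omega>(1) by (simp add: closed_Compl)
    then obtain \<delta> where \<delta>: "0 < \<delta>" "\<And>x. infdist x (- \<Omega>) < \<delta> \<Longrightarrow> u x = 0"
      using Lip_c_vanishes_near[OF u, of "- \<Omega>"] \<Omega>(3) by auto
    have near_u: "near u \<le> ennreal K1 * besov_energy \<nu> q p u"
      using \<delta> by (intro near um Lip_c_mass_finite[OF u p]) blast
    have "mass p u (ball z a) \<le> mass p u (open_nbhd (- \<Omega>) a)"
    proof (rule mass_mono, rule subsetI)
      fix x assume "x \<in> ball z a"
      then show "x \<in> open_nbhd (- \<Omega>) a"
        using infdist_le[OF z, of x] by (simp add: open_nbhd_def dist_commute)
    qed
    also have "\<dots> \<le> ennreal (a powr q) * near u"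
      unfolding near_def by (rule mass_near_le_weighted[OF um q a \<delta>])
    also have "\<dots> \<le> ennreal (a powr q) * (ennreal K1 * besov_energy \<nu> q p u)"
      by (intro mult_left_mono near_u) simp
    finally have ball: "mass p u (ball z a) \<le> ennreal (a powr q) * (ennreal K1 * besov_energy \<nu> q p u)" .
    have "mass p u UNIV = mass p u \<Omega>"
      unfolding mass_def using Lip_c_vanishes[OF u] by (intro nn_integral_cong) (auto simp: indicator_def)
    also have "\<dots> \<le> ennreal K2 * (besov_energy \<nu> q p u + mass p u (ball z a))"
      by (rule poincare[OF um])
    also have "\<dots> \<le> ennreal K2 * (besov_energy \<nu> q p u + ennreal (a powr q) * (ennreal K1 * besov_energy \<nu> q p u))"
      by (intro mult_left_mono add_left_mono ball) simp
    also have "\<dots> = ennreal K3 * besov_energy \<nu> q p u"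
      using K1 K2 by (simp add: K3_def ennreal_mult ennreal_plus distrib_left distrib_right mult_ac)
    finally have mass: "mass p u UNIV \<le> ennreal K3 * besov_energy \<nu> q p u" .
    also have "\<dots> \<le> ennreal K * besov_energy \<nu> q p u"
      by (intro mult_right_mono ennreal_leI) (auto simp: K_def)
    finally show "mass p u UNIV \<le> ennreal K * besov_energy \<nu> q p u" .
    have "(\<integral>\<^sup>+x. ennreal (\<bar>u x\<bar> powr p / infdist x (- \<Omega>) powr q) \<partial>\<nu>)
        \<le> near u + ennreal (1 / a powr q) * mass p u UNIV"
      unfolding near_def by (rule weighted_le_near_plus_mass[OF um q a])
    also have "\<dots> \<le> ennreal K1 * besov_energy \<nu> q p u + ennreal (1 / a powr q) * (ennreal K3 * besov_energy \<nu> q p u)"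
      by (intro add_mono mult_left_mono near_u mass) simp
    also have "\<dots> = ennreal (K1 + 1 / a powr q * K3) * besov_energy \<nu> q p u"
      using K1 K3 by (subst ennreal_plus) (auto simp: ennreal_mult[symmetric] mult.assoc[symmetric] distrib_right)
    also have "\<dots> \<le> ennreal K * besov_energy \<nu> q p u"
      by (intro mult_right_mono ennreal_leI) (auto simp: K_def)
    finally show "(\<integral>\<^sup>+x. ennreal (\<bar>u x\<bar> powr p / infdist x (- \<Omega>) powr q) \<partial>\<nu>)
        \<le> ennreal K * besov_energy \<nu> q p u" .
  qed
qed

lemma hardy_off_thin_set:
  assumes p: "0 < p" and q: "0 < q" and S: "closed S" "S \<noteq> {}"
    and diam: "0 < ediam (UNIV :: 'a set)" and codim: "ennreal q < lower_assouad_codim \<nu> S"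
  shows "\<exists>K\<ge>0. \<forall>u\<in>Lip_c (- S).
    (\<integral>\<^sup>+x. ennreal (\<bar>u x\<bar> powr p / infdist x S powr q) \<partial>\<nu>)
      \<le> ennreal K * (besov_energy \<nu> q p u + mass p u UNIV)"
proof -
  obtain t C a where t: "q < t" and C: "0 \<le> C" and a: "0 < a"
    and thin: "\<And>z r R. z \<in> S \<Longrightarrow> 0 < r \<Longrightarrow> r \<le> R \<Longrightarrow> R \<le> 2 * a \<Longrightarrow>
      measure \<nu> (ball z R \<inter> open_nbhd S r) \<le> C * (r / R) powr t * measure \<nu> (ball z R)"
    using lower_assouad_codim_greaterD[OF codim _ diam] q by (auto simp: less_imp_le)
  obtain K1 where K1: "0 \<le> K1" and near: "\<And>u. u \<in> borel_measurable \<nu> \<Longrightarrow> mass p u UNIV < \<infinity> \<Longrightarrow>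
      \<exists>\<delta>>0. \<forall>x. infdist x S < \<delta> \<longrightarrow> u x = 0 \<Longrightarrow>
      (\<integral>\<^sup>+x\<in>open_nbhd S a. ennreal (\<bar>u x\<bar> powr p / infdist x S powr q) \<partial>\<nu>)
        \<le> ennreal K1 * (besov_energy \<nu> q p u + mass p u UNIV)"
    using hardy_near_thin_set[OF p q t C a S(2) thin] by blast
  show ?thesis
  proof (intro exI[of _ "K1 + 1 / a powr q"] conjI ballI)
    show "0 \<le> K1 + 1 / a powr q" using K1 by simp
    fix u assume u: "u \<in> Lip_c (- S)"
    note um = Lip_c_measurable[OF u]
    let ?E = "besov_energy \<nu> q p u + mass p u UNIV"
    have "(\<integral>\<^sup>+x. ennreal (\<bar>u x\<bar> powr p / infdist x S powr q) \<partial>\<nu>)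
      \<le> (\<integral>\<^sup>+x\<in>open_nbhd S a. ennreal (\<bar>u x\<bar> powr p / infdist x S powr q) \<partial>\<nu>)
        + ennreal (1 / a powr q) * mass p u UNIV"
      by (rule weighted_le_near_plus_mass[OF um q a])
    also have "\<dots> \<le> ennreal K1 * ?E + ennreal (1 / a powr q) * ?E"
      by (intro add_mono mult_left_mono near um Lip_c_mass_finite[OF u p] Lip_c_vanishes_near[OF u S(1) _ S(2)])
        auto
    also have "\<dots> = ennreal (K1 + 1 / a powr q) * ?E"
      using K1 by (simp add: ennreal_plus distrib_right)
    finally show "(\<integral>\<^sup>+x. ennreal (\<bar>u x\<bar> powr p / infdist x S powr q) \<partial>\<nu>)
      \<le> ennreal (K1 + 1 / a powr q) * ?E" .
  qed
qed

lemma weighted_infdist_Un_le: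
  assumes [measurable]: "u \<in> borel_measurable \<nu>" and "S \<noteq> {}" "T \<noteq> {}"
  shows "(\<integral>\<^sup>+x. ennreal (\<bar>u x\<bar> powr p / infdist x (S \<union> T) powr q) \<partial>\<nu>)
    \<le> (\<integral>\<^sup>+x. ennreal (\<bar>u x\<bar> powr p / infdist x S powr q) \<partial>\<nu>)
      + (\<integral>\<^sup>+x. ennreal (\<bar>u x\<bar> powr p / infdist x T powr q) \<partial>\<nu>)"
proof -
  have "ennreal (\<bar>u x\<bar> powr p / infdist x (S \<union> T) powr q)
      \<le> ennreal (\<bar>u x\<bar> powr p / infdist x S powr q) + ennreal (\<bar>u x\<bar> powr p / infdist x T powr q)" for x
    by (cases "infdist x S \<le> infdist x T") (simp_all add: infdist_Un_min assms(2,3) min_def)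
  then show ?thesis
    by (subst nn_integral_add[symmetric]) (auto intro!: nn_integral_mono)
qed

end

section \<open>The Hardy inequality outside a thin set\<close>

lemma hardy_inequalityI:
  assumes "0 \<le> K"
    and "\<And>u. u \<in> Lip_c \<Omega> \<Longrightarrow>
      (\<integral>\<^sup>+x. ennreal (\<bar>u x\<bar> powr p / infdist x (- \<Omega>) powr (\<theta> * p)) \<partial>\<nu>) \<le> ennreal K * besov_energy \<nu> (\<theta> * p) p u"
  shows "hardy_inequality \<nu> \<Omega> \<theta> p"
  unfolding hardy_inequality_def besov_energy_def[symmetric]
proof (intro exI[of _ "max 1 K"] conjI ballI)
  fix u assume u: "u \<in> Lip_c \<Omega>"
  have "(\<integral>\<^sup>+x\<in>\<Omega>. ennreal (\<bar>u x\<bar> powr p / infdist x (- \<Omega>) powr (\<theta> * p)) \<partial>\<nu>)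
      \<le> (\<integral>\<^sup>+x. ennreal (\<bar>u x\<bar> powr p / infdist x (- \<Omega>) powr (\<theta> * p)) \<partial>\<nu>)"
    by (intro nn_integral_mono) (auto simp: indicator_def)
  also note assms(2)[OF u]
  also have "ennreal K * besov_energy \<nu> (\<theta> * p) p u \<le> ennreal (max 1 K) * besov_energy \<nu> (\<theta> * p) p u"
    by (intro mult_right_mono ennreal_leI) auto
  finally show "(\<integral>\<^sup>+x\<in>\<Omega>. ennreal (\<bar>u x\<bar> powr p / infdist x (- \<Omega>) powr (\<theta> * p)) \<partial>\<nu>)
      \<le> ennreal (max 1 K) * besov_energy \<nu> (\<theta> * p) p u" .
qed simp

text \<open>
  The complement of \<open>\<Omega>\<^sub>0 - F\<close> is the union of the thick set \<open>- \<Omega>\<^sub>0\<close> and the thin set \<open>F\<close>, and the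
  distance to a union is the smaller of the two distances. The unweighted integral that the thin set
  leaves over is controlled by the thick set.
\<close>

theorem proposition7p2:
  fixes \<nu> :: "'a::complete_space measure"
    and \<theta> p :: real
    and \<Omega>\<^sub>0 F :: "'a set"
  assumes "doubling_measure \<nu>"
    and "0 < \<theta>" and "\<theta> < 1" and "1 < p"
    and "open \<Omega>\<^sub>0" and "bounded \<Omega>\<^sub>0"
    and "- \<Omega>\<^sub>0 \<noteq> {}"
    and "upper_assouad_codim \<nu> (- \<Omega>\<^sub>0) < ennreal (\<theta> * p)"
    and "closed F" and "F \<subseteq> closure \<Omega>\<^sub>0"
    and "lower_assouad_codim \<nu> F > ennreal (\<theta> * p)"
  shows "hardy_inequality \<nu> (\<Omega>\<^sub>0 - F) \<theta> p"
proof -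
  obtain D where "doubling_space \<nu> D" using assms(1) by (rule doubling_measureD)
  then interpret doubling_space \<nu> D .
  define q where "q = \<theta> * p"
  have p: "0 < p" and q: "0 < q" using assms(2,4) by (auto simp: q_def)
  have mono: "u \<in> Lip_c B" if "u \<in> Lip_c A" "A \<subseteq> B" for u and A B :: "'a set"
    using that by (auto simp: Lip_c_def)
  obtain K where K: "0 \<le> K"
    and mass: "\<And>u. u \<in> Lip_c \<Omega>\<^sub>0 \<Longrightarrow> mass p u UNIV \<le> ennreal K * besov_energy \<nu> q p u"
    and thick: "\<And>u. u \<in> Lip_c \<Omega>\<^sub>0 \<Longrightarrow>
      (\<integral>\<^sup>+x. ennreal (\<bar>u x\<bar> powr p / infdist x (- \<Omega>\<^sub>0) powr q) \<partial>\<nu>) \<le> ennreal K * besov_energy \<nu> q p u"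
    using hardy_thick_complement[OF p q assms(5-7)] assms(8) unfolding q_def by blast
  show ?thesis
  proof (cases "F = {}")
    case True
    then show ?thesis using thick K unfolding q_def by (intro hardy_inequalityI[of K]) auto
  next
    case False
    then obtain x0 where "x0 \<in> \<Omega>\<^sub>0" using assms(10) by fastforce
    moreover obtain z0 where "z0 \<notin> \<Omega>\<^sub>0" using assms(7) by blast
    ultimately have diam: "0 < ediam (UNIV :: 'a set)"
      by (intro ediam_UNIV_pos[of x0 z0]) auto
    obtain L where L: "0 \<le> L" and thin: "\<And>u. u \<in> Lip_c (- F) \<Longrightarrow>
        (\<integral>\<^sup>+x. ennreal (\<bar>u x\<bar> powr p / infdist x F powr q) \<partial>\<nu>)
          \<le> ennreal L * (besov_energy \<nu> q p u + mass p u UNIV)"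
      using hardy_off_thin_set[OF p q assms(9) False diam] assms(11) unfolding q_def by blast
    show ?thesis
    proof (rule hardy_inequalityI[of "K + L * (1 + K)"], goal_cases)
      case 1
      then show ?case using K L by simp
    next
      case (2 u)
      let ?E = "besov_energy \<nu> q p u"
      have u0: "u \<in> Lip_c \<Omega>\<^sub>0" and uF: "u \<in> Lip_c (- F)"
        using 2 by (auto elim!: mono)
      have "- (\<Omega>\<^sub>0 - F) = - \<Omega>\<^sub>0 \<union> F" by auto
      then have "(\<integral>\<^sup>+x. ennreal (\<bar>u x\<bar> powr p / infdist x (- (\<Omega>\<^sub>0 - F)) powr q) \<partial>\<nu>)
          \<le> (\<integral>\<^sup>+x. ennreal (\<bar>u x\<bar> powr p / infdist x (- \<Omega>\<^sub>0) powr q) \<partial>\<nu>)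
            + (\<integral>\<^sup>+x. ennreal (\<bar>u x\<bar> powr p / infdist x F powr q) \<partial>\<nu>)"
        using weighted_infdist_Un_le[OF Lip_c_measurable[OF u0] assms(7) False] by simp
      also have "\<dots> \<le> ennreal K * ?E + ennreal L * (?E + ennreal K * ?E)"
        by (intro add_mono thick u0 order_trans[OF thin[OF uF]] mult_left_mono mass order_refl) simp
      also have "\<dots> = ennreal (K + L * (1 + K)) * ?E"
        using K L by (simp add: ennreal_mult ennreal_plus distrib_left distrib_right mult_ac)
      finally show ?case by (simp add: q_def)
    qed
  qed
qed

end
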